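(* Let $0<\alpha<\tfrac12$, let $L:\mathbb R\to(0,\infty)$ be slowly varying, and let $\mu$ be a probability measure on $\mathbb N$ with $\mu(\{n,n+1,\ldots\})\sim n^{-\alpha}L(n)$ as $n\to\infty$ and $\gcd\{n\in\mathbb N:\mu(\{n\})>0\}=1$. Assume that the renewal weights $q_n$ of $\mu$ satisfy $$q_n\sim\frac{1}{\Gamma(\alpha)\Gamma(1-\alpha)}\,\frac{n^{\alpha-1}}{L(n)}\quad\text{as }n\to\infty.$$ Then $$\mathbf P(0\sim i)\sim C_\alpha\,\frac{i^{2\alpha-1}}{L(i)^2}\quad\text{as }i\to\infty,\qquad\text{where}\quad C_\alpha:=\frac{1}{\sum_{m\ge0}q_m^2}\,\frac{\Gamma(1-2\alpha)}{\Gamma(\alpha)\Gamma(1-\alpha)^3}.$$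
   Context: Here $\mathbb N=\{1,2,\ldots\}$. Between two real sequences, $f(n)\sim g(n)$ means $f(n)/g(n)\to1$; between integers, $\sim$ denotes the random equivalence relation defined next. Let $(R_i)_{i\in\mathbb Z}$ be i.i.d. with distribution $\mu$. $\mathcal G_\mu$ is the random directed graph with vertex set $\mathbb Z$ and edge set $\{(i,i-R_i):i\in\mathbb Z\}$. For $i,j\in\mathbb Z$, $i\sim j$ means that $i$ and $j$ belong to the same connected component of $\mathcal G_\mu$ (edge directions ignored). Renewal weights: $q_n:=\mathbf P(\tilde R_1+\cdots+\tilde R_j=n\text{ for some }j\ge0)$, $n\ge0$, with $\tilde R_1,\tilde R_2,\ldots$ independent with distribution $\mu$ (so $q_0=1$). *)

theory Defs
  imports "HOL-Probability.Probability" "HOL-Library.Landau_Symbols"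
begin

(* Measurability of L is not required: the notion is only the limit relation (at infinity). *)
definition slowly_varying :: "(real \<Rightarrow> real) \<Rightarrow> bool" where
  "slowly_varying L \<longleftrightarrow> (\<forall>c>0. ((\<lambda>x. L (c * x) / L x) \<longlongrightarrow> 1) at_top)"

(* The digraph with vertex set UNIV :: int set for the realisation r of (R_i), given by its edges. *)
definition jump_graph :: "(int \<Rightarrow> nat) \<Rightarrow> (int \<times> int) set" where
  "jump_graph r = {(i, i - int (r i)) | i. i \<in> UNIV}"

(* Joined by a finite path in which edges may be traversed in either direction. *)
definition same_component :: "('v \<times> 'v) set \<Rightarrow> 'v \<Rightarrow> 'v \<Rightarrow> bool" where
  "same_component E i j \<longleftrightarrow> (i, j) \<in> (E \<union> E\<inverse>)\<^sup>*"

(* The i.i.d. sequence is realised as the coordinates x 0, x 1, ... of the product space;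
   the empty sum (j = 0) accounts for the value 1 at n = 0. *)
definition renewal_weight :: "nat pmf \<Rightarrow> nat \<Rightarrow> real" where
  "renewal_weight \<mu> n =
     measure (\<Pi>\<^sub>M k\<in>(UNIV :: nat set). measure_pmf \<mu>) {x. \<exists>j. (\<Sum>k<j. x k) = n}"

definition connection_const :: "nat pmf \<Rightarrow> real \<Rightarrow> real" where
  "connection_const \<mu> \<alpha> =
     1 / (\<Sum>m. (renewal_weight \<mu> m)\<^sup>2) *
     (Gamma (1 - 2 * \<alpha>) / (Gamma \<alpha> * Gamma (1 - \<alpha>) ^ 3))"

end

theory Submission
  imports Defs "HOL-Real_Asymp.Real_Asymp"
begin

text \<open>
  Write Q n for the renewal weights, T n for the tail \<mu>({n, n+1, ...}), and
  s(i) for the sum of Q m * Q (m + i) over all m. The proof rests on the exact identity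
  P(0 ~ i) = s(i) / s(0), after which only the asymptotics of s is needed.
  
  The identity. All edges point to the left and every vertex has one outgoing edge, so 0 ~ i
  holds iff the two ancestral lines meet. Explore them by always moving the larger of the two current
  points: its jump is independent of everything the later steps look at, so the distance of the
  two points is a Markov chain d \<mapsto> |d - k| with k drawn from \<mu>, and P(0 ~ i) is the
  probability that this chain, started at i, hits 0. This hitting probability is the limit of the
  probabilities of hitting within n steps, which by induction on n lie below every nonnegative function
  that is harmonic off 0 and equals 1 at 0. The renewal equation says precisely that s is
  harmonic off 0, so P(0 ~ i) \<le> s(i) / s(0), and the difference h is nonnegative, harmonic off 0,
  zero at 0 and, because s vanishes at infinity, attains its maximum. If that maximum were positive,
  look at the largest i attaining it: harmonicity propagates the maximum to |i - k| for all k in the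
  support of \<mu>, and some k > 2 * i in the support leads beyond i, a contradiction
  (meeting_prob_tendsto). Heuristically, s(i) is the expected number of common points of two
  independent lines from 0 and i, and s(0) the expected number of them once the lines have met.
  
  The asymptotics. The hypotheses give Q n ~ c / (n * T n) with c = 1 / (\<Gamma>(\<alpha>) \<Gamma>(1 - \<alpha>)), which eliminates
  L; this matters because no regularity of L is assumed beyond the limit relation, so that Potter
  bounds and convergence of L (x n) / L n for integers close to x * n have to come from
  the monotonicity of T. With w n = n * T n,
    s(i) * w i ^ 2 / i = integral over x > 0 of (w i * Q (floor (i x))) * (w i * Q (floor (i x) + i)),
  whose integrand converges to c ^ 2 * x powr (\<alpha> - 1) * (1 + x) powr (\<alpha> - 1); Potter
  bounds provide an integrable majorant exactly because \<alpha> < 1/2, and the limit is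
  c ^ 2 * Beta \<alpha> (1 - 2 * \<alpha>) (correlation_asymptotics).
\<close>

section \<open>Monotone regularly varying sequences\<close>

text \<open>
  Regular variation is only required along integer multiples, since the tail of \<mu> is only
  controlled at integers; monotonicity supplies the rest.
\<close>

locale regularly_varying_seq =
  fixes T :: "nat \<Rightarrow> real" and \<alpha> :: real
  assumes index_pos: "0 < \<alpha>"
    and T_pos: "T n > 0"
    and T_antimono: "m \<le> n \<Longrightarrow> T n \<le> T m"
    and T_multiples: "k \<ge> 1 \<Longrightarrow> (\<lambda>n. T (k * n) / T n) \<longlonglongrightarrow> real k powr (-\<alpha>)"
begin

lemma ratio_of_multiples:
  assumes "a \<ge> 1" "b \<ge> 1" "p \<ge> (1::nat)"
  shows "(\<lambda>n. T (a * (n div p)) / T (b * (n div p))) \<longlonglongrightarrow> (real a / real b) powr (-\<alpha>)"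
proof -
  have "(\<lambda>m. (T (a * m) / T m) / (T (b * m) / T m)) \<longlonglongrightarrow> real a powr (-\<alpha>) / real b powr (-\<alpha>)"
    using assms by (intro tendsto_divide T_multiples) auto
  also have "(\<lambda>m. (T (a * m) / T m) / (T (b * m) / T m)) = (\<lambda>m. T (a * m) / T (b * m))"
    using T_pos by (auto simp: fun_eq_iff less_imp_neq[symmetric])
  also have "real a powr (-\<alpha>) / real b powr (-\<alpha>) = (real a / real b) powr (-\<alpha>)"
    by (simp add: powr_divide)
  finally have "(\<lambda>m. T (a * m) / T (b * m)) \<longlonglongrightarrow> (real a / real b) powr (-\<alpha>)" .
  moreover have "filterlim (\<lambda>n. n div p) at_top at_top"
    unfolding filterlim_at_top
  proof
    fix Z
    show "eventually (\<lambda>n. Z \<le> n div p) at_top"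
      using eventually_ge_at_top[of "Z * p"]
      by eventually_elim (use assms in \<open>simp add: less_eq_div_iff_mult_less_eq\<close>)
  qed
  ultimately show ?thesis
    by (rule filterlim_compose)
qed

text \<open>
  Every large n lies between two multiples of the same number n div p whose ratio is close to 1.
  This reduces ratios of T at arbitrary integers to ratios of multiples.
\<close>

lemma block_bounds:
  fixes n p :: nat
  assumes "p \<ge> 1" "n \<ge> p * p"
  shows "p * (n div p) \<le> n" "n \<le> (p + 1) * (n div p)"
proof -
  show "p * (n div p) \<le> n" by simp
  \<comment> \<open>The quotient is at least p, hence larger than the remainder.\<close>
  have "p \<le> n div p"
    using assms by (simp add: less_eq_div_iff_mult_less_eq)
  moreover have "n = p * (n div p) + n mod p" "n mod p < p"
    using assms by auto
  ultimately have "n \<le> p * (n div p) + n div p" by linarith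
  thus "n \<le> (p + 1) * (n div p)" by simp
qed

text \<open>
  Squeeze j n between a * m and b * m, and n between p * m and (p + 1) * m, where m = n div p and
  a / p < x < b / (p + 1). By monotonicity T (j n) / T n then lies between two ratios of
  multiples, whose limits are within any prescribed distance of x powr (-\<alpha>) once p is large.
\<close>

lemma ratio_tendsto:
  assumes j: "(\<lambda>n. real (j n) / real n) \<longlonglongrightarrow> x" and x: "x > 0"
  shows "(\<lambda>n. T (j n) / T n) \<longlonglongrightarrow> x powr (-\<alpha>)"
proof (rule order_tendstoI)
  fix l assume l: "l < x powr (-\<alpha>)"
  define b where "b p = nat \<lfloor>x * (real p + 1)\<rfloor> + 1" for p :: nat
  have b: "x * (real p + 1) < real (b p)" "real (b p) \<le> x * (real p + 1) + 1" for p
  proof -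
    have "x * (real p + 1) \<ge> 0" using x by simp
    hence "real (b p) = of_int \<lfloor>x * (real p + 1)\<rfloor> + 1"
      unfolding b_def by simp
    thus "x * (real p + 1) < real (b p)" "real (b p) \<le> x * (real p + 1) + 1" by linarith+
  qed
  have "(\<lambda>p. real (b p) / real p) \<longlonglongrightarrow> x"
  proof (rule tendsto_sandwich)
    show "(\<lambda>p. x * (real p + 1) / real p) \<longlonglongrightarrow> x" by real_asymp
    show "(\<lambda>p. (x * (real p + 1) + 1) / real p) \<longlonglongrightarrow> x" by real_asymp
    show "eventually (\<lambda>p. x * (real p + 1) / real p \<le> real (b p) / real p) sequentially"
      using b(1) by (intro always_eventually allI divide_right_mono[OF less_imp_le]) auto
    show "eventually (\<lambda>p. real (b p) / real p \<le> (x * (real p + 1) + 1) / real p) sequentially"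
      using b(2) by (intro always_eventually allI divide_right_mono) auto
  qed
  hence "(\<lambda>p. (real (b p) / real p) powr (-\<alpha>)) \<longlonglongrightarrow> x powr (-\<alpha>)"
    using x by (intro tendsto_powr tendsto_const) auto
  hence "eventually (\<lambda>p. l < (real (b p) / real p) powr (-\<alpha>) \<and> p \<ge> 1) sequentially"
    using l by (intro eventually_conj order_tendstoD eventually_ge_at_top)
  then obtain p where p: "l < (real (b p) / real p) powr (-\<alpha>)" "p \<ge> 1"
    by (auto simp: eventually_sequentially)
  have b1: "b p \<ge> 1" by (simp add: b_def)
  have "eventually (\<lambda>n. l < T (b p * (n div p)) / T (p * (n div p))) sequentially"
    by (rule order_tendstoD(1)[OF ratio_of_multiples]) (use p b1 in auto)
  moreover have "x < real (b p) / (real p + 1)"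
    using b(1)[of p] by (simp add: field_simps)
  hence "eventually (\<lambda>n. real (j n) / real n < real (b p) / (real p + 1)) sequentially"
    by (rule order_tendstoD(2)[OF j])
  ultimately show "eventually (\<lambda>n. l < T (j n) / T n) sequentially"
    using eventually_ge_at_top[of "p * p"]
  proof eventually_elim
    case (elim n)
    note bl = block_bounds[OF p(2) elim(3)]
    have n: "n > 0" using p elim(3) by (cases n) auto
    have "real (j n) < real (b p) * real n / (real p + 1)"
      using elim(2) n by (simp add: field_simps)
    also have "\<dots> \<le> real (b p) * real ((p + 1) * (n div p)) / (real p + 1)"
      using bl(2) by (intro divide_right_mono mult_left_mono) (auto simp del: of_nat_mult)
    also have "\<dots> = real (b p * (n div p))"
      by (simp add: field_simps)
    finally have "j n \<le> b p * (n div p)" by linarith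
    hence "T (b p * (n div p)) \<le> T (j n)" by (rule T_antimono)
    moreover have "T n \<le> T (p * (n div p))" by (rule T_antimono) (rule bl)
    ultimately have "T (b p * (n div p)) / T (p * (n div p)) \<le> T (j n) / T n"
      using T_pos by (intro frac_le) (auto intro: less_imp_le)
    thus ?case using elim(1) by linarith
  qed
next
  fix u assume u: "x powr (-\<alpha>) < u"
  define a where "a p = nat \<lceil>x * real p\<rceil> - 1" for p :: nat
  have big: "eventually (\<lambda>p. x * real p > 1) sequentially"
    using x by real_asymp
  have a: "real (a p) < x * real p" "x * real p - 1 \<le> real (a p)" "a p \<ge> 1" if "x * real p > 1" for p
  proof -
    have "nat \<lceil>x * real p\<rceil> \<ge> 2" using that by linarith
    hence "real (a p) = of_int \<lceil>x * real p\<rceil> - 1" "a p \<ge> 1"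
      by (auto simp: a_def of_nat_diff)
    thus "real (a p) < x * real p" "x * real p - 1 \<le> real (a p)" "a p \<ge> 1" by linarith+
  qed
  have "(\<lambda>p. real (a p) / (real p + 1)) \<longlonglongrightarrow> x"
  proof (rule tendsto_sandwich)
    show "(\<lambda>p. (x * real p - 1) / (real p + 1)) \<longlonglongrightarrow> x" by real_asymp
    show "(\<lambda>p. (x * real p) / (real p + 1)) \<longlonglongrightarrow> x" by real_asymp
    show "eventually (\<lambda>p. (x * real p - 1) / (real p + 1) \<le> real (a p) / (real p + 1)) sequentially"
      using big by eventually_elim (intro divide_right_mono a, auto)
    show "eventually (\<lambda>p. real (a p) / (real p + 1) \<le> (x * real p) / (real p + 1)) sequentially"
      using big by eventually_elim (intro divide_right_mono less_imp_le a, auto)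
  qed
  hence "(\<lambda>p. (real (a p) / (real p + 1)) powr (-\<alpha>)) \<longlonglongrightarrow> x powr (-\<alpha>)"
    using x by (intro tendsto_powr tendsto_const) auto
  hence "eventually (\<lambda>p. (real (a p) / (real p + 1)) powr (-\<alpha>) < u \<and> p \<ge> 1 \<and> x * real p > 1) sequentially"
    using u by (intro eventually_conj order_tendstoD eventually_ge_at_top big)
  then obtain p where p: "(real (a p) / (real p + 1)) powr (-\<alpha>) < u" "p \<ge> 1" "x * real p > 1"
    by (auto simp: eventually_sequentially)
  note ap = a[OF p(3)]
  have "eventually (\<lambda>n. T (a p * (n div p)) / T ((p + 1) * (n div p)) < u) sequentially"
    by (rule order_tendstoD(2)[OF ratio_of_multiples]) (use p ap in \<open>auto simp: add.commute\<close>)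
  moreover have "real (a p) / real p < x"
    using ap(1) p(2) by (simp add: field_simps)
  hence "eventually (\<lambda>n. real (a p) / real p < real (j n) / real n) sequentially"
    by (rule order_tendstoD(1)[OF j])
  ultimately show "eventually (\<lambda>n. T (j n) / T n < u) sequentially"
    using eventually_ge_at_top[of "p * p"]
  proof eventually_elim
    case (elim n)
    note bl = block_bounds[OF p(2) elim(3)]
    have n: "n > 0" using p elim(3) by (cases n) auto
    have "real (a p * (n div p)) = real (a p) * real (p * (n div p)) / real p"
      using p(2) by simp
    also have "\<dots> \<le> real (a p) * real n / real p"
      using bl(1) by (intro divide_right_mono mult_left_mono) (auto simp del: of_nat_mult)
    also have "\<dots> < real (j n)"
      using elim(2) n p(2) by (simp add: field_simps)
    finally have "a p * (n div p) \<le> j n" by linarith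
    hence "T (j n) \<le> T (a p * (n div p))" by (rule T_antimono)
    moreover have "T ((p + 1) * (n div p)) \<le> T n" by (rule T_antimono) (rule bl)
    ultimately have "T (j n) / T n \<le> T (a p * (n div p)) / T ((p + 1) * (n div p))"
      using T_pos by (intro frac_le) (auto intro: less_imp_le)
    thus ?case using elim(1) by linarith
  qed
qed

end

text \<open>
  The common core of both Potter bounds: iterate the doubling inequality until m is within a factor
  2 of n. The finitely many n below N only affect the constant.
\<close>

lemma almost_increasing_if_doubling:
  fixes u :: "nat \<Rightarrow> real"
  assumes pos: "\<And>n. n \<ge> 1 \<Longrightarrow> u n > 0"
    and N: "N \<ge> 1"
    and doubling: "\<And>n. n \<ge> N \<Longrightarrow> u n \<le> u (2 * n)"
    and near: "\<And>n m. n \<ge> N \<Longrightarrow> n \<le> m \<Longrightarrow> m \<le> 2 * n \<Longrightarrow> u n \<le> K * u m"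
  shows "\<exists>C>0. \<forall>n\<ge>1. \<forall>m\<ge>n. u n \<le> C * u m"
proof -
  have late: "u n \<le> K * u m" if "n \<ge> N" "n \<le> m" for n m
    using that
  proof (induction "m - n" arbitrary: n rule: less_induct)
    case less
    show ?case
    proof (cases "m \<le> 2 * n")
      case True
      thus ?thesis using near less.prems by blast
    next
      case False
      have "u n \<le> u (2 * n)" using doubling less.prems by blast
      also have "\<dots> \<le> K * u m"
        by (rule less.hyps) (use False less.prems N in auto)
      finally show ?thesis .
    qed
  qed
  define hi lo where "hi = Max (u ` {1..N})" and "lo = Min (u ` {1..N})"
  have hi: "u n \<le> hi" and lo: "lo \<le> u n" if "1 \<le> n" "n \<le> N" for n :: nat
    using that by (auto simp: hi_def lo_def)
  have "lo \<in> u ` {1..N}" unfolding lo_def using N by (intro Min_in) auto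
  hence lo0: "lo > 0" using pos by auto
  have hi0: "hi \<ge> lo" using hi[of N] lo[of N] N by linarith
  have uN: "u N > 0" using pos N by blast
  have "u N \<le> K * u N" using near[of N N] by simp
  hence K: "K \<ge> 1" using uN by simp
  define C where "C = hi / lo * K"
  have early: "u n \<le> hi / lo * u m" if "1 \<le> n" "n \<le> N" "1 \<le> m" "m \<le> N" for n m :: nat
  proof -
    have "u n \<le> hi / lo * lo" using hi that lo0 by simp
    also have "\<dots> \<le> hi / lo * u m" using lo that lo0 hi0 by (intro mult_left_mono) auto
    finally show ?thesis .
  qed
  have hl: "hi / lo \<ge> 1" using lo0 hi0 by simp
  show ?thesis
  proof (intro exI[of _ C] conjI allI impI)
    show "C > 0" using lo0 hi0 K by (auto simp: C_def)
    fix n m :: nat assume nm: "1 \<le> n" "n \<le> m"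
    have um: "u m > 0" "u m \<ge> 0" using pos[of m] nm by auto
    consider "N \<le> n" | "n \<le> N" "N \<le> m" | "m \<le> N" by linarith
    thus "u n \<le> C * u m"
    proof cases
      case 1
      have "u n \<le> 1 * (K * u m)" using late 1 nm by simp
      also have "\<dots> \<le> hi / lo * (K * u m)" using um K by (intro mult_right_mono hl) auto
      finally show ?thesis by (simp add: C_def)
    next
      case 2
      have "u n \<le> hi / lo * u N" using early nm 2 N by blast
      also have "\<dots> \<le> hi / lo * (K * u m)" using hl by (intro mult_left_mono late 2) auto
      finally show ?thesis by (simp add: C_def)
    next
      case 3
      have "u n \<le> hi / lo * u m" using early nm 3 N by auto
      also have "\<dots> \<le> hi / lo * (K * u m)" using hl um K by (intro mult_left_mono) auto
      finally show ?thesis by (simp add: C_def)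
    qed
  qed
qed

context regularly_varying_seq
begin

text \<open>
  By T (2 n) / T n \<longlongrightarrow> 2 powr (-\<alpha>), the sequence n powr (\<alpha> + \<epsilon>) * T n eventually increases along doublings,
  and n powr (\<alpha> - \<epsilon>) * T n decreases; the second case is the first for the reciprocal.
\<close>

lemma potter_lower:
  assumes \<epsilon>: "\<epsilon> > 0"
  shows "\<exists>C>0. \<forall>n\<ge>1. \<forall>m\<ge>n. real n powr (\<alpha> + \<epsilon>) * T n \<le> C * (real m powr (\<alpha> + \<epsilon>) * T m)"
proof -
  have "eventually (\<lambda>n. T (2 * n) / T n > 2 powr (-(\<alpha> + \<epsilon>)) \<and> n \<ge> 1) sequentially"
    using \<epsilon> by (intro eventually_conj eventually_ge_at_top order_tendstoD(1)[OF T_multiples[of 2]]) auto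
  then obtain N where N: "\<And>n. n \<ge> N \<Longrightarrow> T (2 * n) / T n > 2 powr (-(\<alpha> + \<epsilon>)) \<and> n \<ge> 1"
    by (auto simp: eventually_sequentially)
  have step: "T n \<le> 2 powr (\<alpha> + \<epsilon>) * T (2 * n)" if "n \<ge> N" for n
    using N[OF that] T_pos[of n] unfolding powr_minus by (simp add: field_simps)
  show ?thesis
  proof (rule almost_increasing_if_doubling[where N = N and K = "2 powr (\<alpha> + \<epsilon>)"])
    show "real n powr (\<alpha> + \<epsilon>) * T n > 0" if "n \<ge> 1" for n
      using that T_pos[of n] by simp
    show "N \<ge> 1" using N[of N] by simp
    show "real n powr (\<alpha> + \<epsilon>) * T n \<le> real (2 * n) powr (\<alpha> + \<epsilon>) * T (2 * n)" if "n \<ge> N" for n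
      using mult_left_mono[OF step[OF that], of "real n powr (\<alpha> + \<epsilon>)"]
      by (simp add: powr_mult algebra_simps)
    show "real n powr (\<alpha> + \<epsilon>) * T n \<le> 2 powr (\<alpha> + \<epsilon>) * (real m powr (\<alpha> + \<epsilon>) * T m)"
      if "n \<ge> N" "n \<le> m" "m \<le> 2 * n" for n m
    proof -
      have "T n \<le> 2 powr (\<alpha> + \<epsilon>) * T (2 * n)" by (rule step) fact
      also have "\<dots> \<le> 2 powr (\<alpha> + \<epsilon>) * T m" using that by (intro mult_left_mono T_antimono) auto
      finally have "real n powr (\<alpha> + \<epsilon>) * T n \<le> real m powr (\<alpha> + \<epsilon>) * (2 powr (\<alpha> + \<epsilon>) * T m)"
        using that \<epsilon> index_pos T_pos[of n] by (intro mult_mono powr_mono2) (auto intro: less_imp_le)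
      thus ?thesis by (simp add: algebra_simps)
    qed
  qed
qed

lemma potter_upper:
  assumes \<epsilon>: "\<epsilon> > 0" "\<epsilon> < \<alpha>"
  shows "\<exists>C>0. \<forall>n\<ge>1. \<forall>m\<ge>n. real m powr (\<alpha> - \<epsilon>) * T m \<le> C * (real n powr (\<alpha> - \<epsilon>) * T n)"
proof -
  have "eventually (\<lambda>n. T (2 * n) / T n < 2 powr (-(\<alpha> - \<epsilon>)) \<and> n \<ge> 1) sequentially"
    using \<epsilon> by (intro eventually_conj eventually_ge_at_top order_tendstoD(2)[OF T_multiples[of 2]]) auto
  then obtain N where N: "\<And>n. n \<ge> N \<Longrightarrow> T (2 * n) / T n < 2 powr (-(\<alpha> - \<epsilon>)) \<and> n \<ge> 1"
    by (auto simp: eventually_sequentially)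
  have step: "2 powr (\<alpha> - \<epsilon>) * T (2 * n) \<le> T n" if "n \<ge> N" for n
    using N[OF that] T_pos[of n] unfolding powr_minus by (simp add: field_simps)
  define v where "v n = real n powr (\<alpha> - \<epsilon>) * T n" for n
  have v_pos: "v n > 0" if "n \<ge> 1" for n
    using that T_pos[of n] by (simp add: v_def)
  have "\<exists>C>0. \<forall>n\<ge>1. \<forall>m\<ge>n. inverse (v n) \<le> C * inverse (v m)"
  proof (rule almost_increasing_if_doubling[where N = N and K = "2 powr (\<alpha> - \<epsilon>)"])
    show "inverse (v n) > 0" if "n \<ge> 1" for n
      using v_pos[OF that] by simp
    show "N \<ge> 1" using N[of N] by simp
    show "inverse (v n) \<le> inverse (v (2 * n))" if "n \<ge> N" for n
    proof (rule le_imp_inverse_le)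
      show "v (2 * n) \<le> v n"
        using mult_left_mono[OF step[OF that], of "real n powr (\<alpha> - \<epsilon>)"]
        by (simp add: v_def powr_mult algebra_simps)
      show "v (2 * n) > 0" using N[OF that] by (intro v_pos) auto
    qed
    show "inverse (v n) \<le> 2 powr (\<alpha> - \<epsilon>) * inverse (v m)" if "n \<ge> N" "n \<le> m" "m \<le> 2 * n" for n m
    proof -
      have "v m \<le> real (2 * n) powr (\<alpha> - \<epsilon>) * T n"
        unfolding v_def using that \<epsilon> T_pos[of m]
        by (intro mult_mono powr_mono2 T_antimono) (auto intro: less_imp_le)
      also have "\<dots> = 2 powr (\<alpha> - \<epsilon>) * v n" by (simp add: v_def powr_mult)
      finally show ?thesis
        using v_pos[of n] v_pos[of m] N[OF that(1)] that by (simp add: field_simps)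
    qed
  qed
  then obtain C where C: "C > 0" "\<And>n m. n \<ge> 1 \<Longrightarrow> m \<ge> n \<Longrightarrow> inverse (v n) \<le> C * inverse (v m)"
    by blast
  have "v m \<le> C * v n" if "n \<ge> 1" "m \<ge> n" for n m
    using C(2)[OF that] v_pos[of n] v_pos[of m] that by (simp add: field_simps)
  thus ?thesis using C(1) unfolding v_def by blast
qed

end

section \<open>The Beta integral on the half-line and step functions\<close>

text \<open>
  Substitute x = t / (1 - t) in the Beta integral over the unit interval.
\<close>

lemma beta_prime_integral:
  fixes a b :: real
  assumes a: "a > 0" and b: "b > 0"
  defines "f \<equiv> (\<lambda>x::real. indicator {0<..} x * (x powr (a - 1) * (1 + x) powr (-(a + b))))"
  shows "integrable lborel f" "integral\<^sup>L lborel f = Beta a b"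
proof -
  define h where "h = (\<lambda>x::real. x powr (a - 1) * (1 + x) powr (-(a + b)))"
  define g where "g = (\<lambda>t::real. t / (1 - t))"
  define g' where "g' = (\<lambda>t::real. 1 / (1 - t) ^ 2)"
  have "((\<lambda>t. t powr (a - 1) * (1 - t) powr (b - 1)) has_integral Beta a b) {0..1}"
    by (rule has_integral_Beta_real) fact+
  hence B: "((\<lambda>t. t powr (a - 1) * (1 - t) powr (b - 1)) has_integral Beta a b) {0<..<1}"
    by (simp add: has_integral_Icc_iff_Ioo)
  have eq: "t powr (a - 1) * (1 - t) powr (b - 1) = \<bar>g' t\<bar> *\<^sub>R h (g t)" if "t \<in> {0<..<1}" for t
  proof -
    have t: "0 < t" "0 < 1 - t" using that by auto
    have "1 + t / (1 - t) = 1 / (1 - t)" using t by (simp add: field_simps)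
    moreover have "(1 / (1 - t)) powr (-(a + b)) = (1 - t) powr (a + b)"
      using t powr_minus_divide[of "1 - t" "a + b"] powr_minus[of "1 / (1 - t)" "a + b"] by (simp add: powr_divide)
    ultimately have "\<bar>g' t\<bar> *\<^sub>R h (g t) = (t powr (a - 1) / (1 - t) powr (a - 1)) * (1 - t) powr (a + b) / (1 - t) powr 2"
      using t by (simp add: g_def g'_def h_def powr_divide)
    also have "\<dots> = t powr (a - 1) * ((1 - t) powr (a + b) / ((1 - t) powr (a - 1) * (1 - t) powr 2))"
      by simp
    also have "(1 - t) powr (a + b) / ((1 - t) powr (a - 1) * (1 - t) powr 2) = (1 - t) powr (b - 1)"
      by (simp add: powr_add[symmetric] powr_diff[symmetric] algebra_simps)
    finally show ?thesis by simp
  qed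
  have hi: "((\<lambda>t. \<bar>g' t\<bar> *\<^sub>R h (g t)) has_integral Beta a b) {0<..<1}"
    by (rule has_integral_eq[OF eq B])
  have "(\<lambda>t. \<bar>g' t\<bar> *\<^sub>R h (g t)) absolutely_integrable_on {0<..<1}"
    using hi by (intro nonnegative_absolutely_integrable_1) (auto simp: h_def integrable_on_def)
  moreover have "integral {0<..<1} (\<lambda>t. \<bar>g' t\<bar> *\<^sub>R h (g t)) = Beta a b"
    using hi by (rule integral_unique)
  moreover have "(g has_field_derivative g' t) (at t within {0<..<1})" if "t \<in> {0<..<1}" for t
    unfolding g_def g'_def
    using that by (auto intro!: derivative_eq_intros simp: field_simps power2_eq_square)
  moreover have "inj_on g {0<..<1}"
    by (auto simp: inj_on_def g_def field_simps)
  ultimately have "h absolutely_integrable_on (g ` {0<..<1}) \<and> integral (g ` {0<..<1}) h = Beta a b"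
    using has_absolute_integral_change_of_variables_1'[of "{0<..<1}" g g' h "Beta a b"] by auto
  moreover have "g ` {0<..<1} = {0<..}"
  proof (intro equalityI subsetI)
    fix x :: real assume "x \<in> {0<..}"
    hence "x = g (x / (1 + x))" "x / (1 + x) \<in> {0<..<1}"
      by (auto simp: g_def field_simps)
    thus "x \<in> g ` {0<..<1}" by blast
  qed (auto simp: g_def)
  ultimately have h: "set_integrable lebesgue {0<..} h" "integral {0<..} h = Beta a b"
    by auto
  have f: "f = (\<lambda>x. indicator {0<..} x *\<^sub>R h x)" by (simp add: f_def h_def)
  have meas: "f \<in> borel_measurable lborel" unfolding f_def by measurable
  have int: "integrable lebesgue f" using h(1) unfolding set_integrable_def f .
  thus "integrable lborel f" using meas by (simp add: integrable_completion)
  have "integral\<^sup>L lborel f = integral\<^sup>L lebesgue f"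
    using meas by (simp add: integral_completion)
  also have "\<dots> = set_lebesgue_integral lebesgue {0<..} h"
    by (simp add: set_lebesgue_integral_def f)
  also have "\<dots> = Beta a b" using h by (simp add: set_lebesgue_integral_eq_integral)
  finally show "integral\<^sup>L lborel f = Beta a b" .
qed

text \<open>
  Writes a series as the integral of a step function of mesh 1 / i, so that a sum over m becomes accessible to
  dominated convergence after rescaling m = i * x.
\<close>

lemma nn_integral_of_nat_floor:
  fixes f :: "nat \<Rightarrow> ennreal"
  assumes i: "i > 0"
  shows "(\<integral>\<^sup>+x. indicator {0..} x * f (nat \<lfloor>real i * x\<rfloor>) \<partial>lborel) = (\<Sum>m. f m) * ennreal (1 / real i)"
proof -
  define A where "A m = {real m / real i ..< real (Suc m) / real i}" for m
  have mem: "x \<in> A m \<longleftrightarrow> x \<ge> 0 \<and> nat \<lfloor>real i * x\<rfloor> = m" for x m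
  proof -
    have "x \<in> A m \<longleftrightarrow> real m \<le> real i * x \<and> real i * x < real m + 1"
      using i by (auto simp: A_def field_simps)
    also have "\<dots> \<longleftrightarrow> \<lfloor>real i * x\<rfloor> = int m"
      by (auto simp: floor_eq_iff)
    also have "\<dots> \<longleftrightarrow> real i * x \<ge> 0 \<and> nat \<lfloor>real i * x\<rfloor> = m"
      by (smt (verit) zero_le_floor nat_eq_iff of_nat_0_le_iff)
    finally show ?thesis using i by (auto simp: zero_le_mult_iff)
  qed
  have "indicator {0..} x * f (nat \<lfloor>real i * x\<rfloor>) = (\<Sum>m. f m * indicator (A m) x)" for x
  proof (cases "x \<ge> 0")
    case True
    have "(\<Sum>m. f m * indicator (A m) x) = (\<Sum>m\<in>{nat \<lfloor>real i * x\<rfloor>}. f m * indicator (A m) x)"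
      by (rule suminf_finite) (auto simp: mem indicator_def)
    thus ?thesis using True by (simp add: mem indicator_def)
  qed (simp add: mem indicator_def)
  hence "(\<integral>\<^sup>+x. indicator {0..} x * f (nat \<lfloor>real i * x\<rfloor>) \<partial>lborel)
           = (\<integral>\<^sup>+x. (\<Sum>m. f m * indicator (A m) x) \<partial>lborel)" by simp
  also have "\<dots> = (\<Sum>m. \<integral>\<^sup>+x. f m * indicator (A m) x \<partial>lborel)"
    by (rule nn_integral_suminf) (auto simp: A_def)
  also have "\<dots> = (\<Sum>m. f m * ennreal (1 / real i))"
  proof (rule suminf_cong)
    fix m
    have "emeasure lborel (A m) = ennreal (1 / real i)"
      unfolding A_def using i by (subst emeasure_lborel_Ico) (auto simp: field_simps)
    thus "(\<integral>\<^sup>+x. f m * indicator (A m) x \<partial>lborel) = f m * ennreal (1 / real i)"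
      by (subst nn_integral_cmult_indicator) (auto simp: A_def)
  qed
  finally show ?thesis by (simp add: ennreal_suminf_multc)
qed

section \<open>Correlations of regularly varying renewal weights\<close>

locale renewal_asymptotics = regularly_varying_seq +
  fixes Q :: "nat \<Rightarrow> real" and c :: real
  assumes index_less: "\<alpha> < 1 / 2"
    and Q_nonneg: "Q n \<ge> 0"
    and c_pos: "c > 0"
    and Q_limit: "(\<lambda>n. Q n * (real n * T n)) \<longlonglongrightarrow> c"
begin

text \<open>
  The reciprocal scale of Q: by hypothesis Q n is asymptotic to c / w n.
\<close>

definition w :: "nat \<Rightarrow> real" where "w n = real n * T n"

lemma w_pos: "n \<ge> 1 \<Longrightarrow> w n > 0"
  using T_pos[of n] by (simp add: w_def)

lemma w_nonneg: "w n \<ge> 0"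
  using T_pos[of n] by (simp add: w_def)

lemma w_ratio_tendsto:
  assumes m: "(\<lambda>i. real (m i) / real i) \<longlonglongrightarrow> y" and y: "y > 0"
  shows "(\<lambda>i. w (m i) / w i) \<longlonglongrightarrow> y powr (1 - \<alpha>)"
proof -
  have "(\<lambda>i. real (m i) / real i * (T (m i) / T i)) \<longlonglongrightarrow> y * y powr (-\<alpha>)"
    by (intro tendsto_mult m ratio_tendsto y)
  also have "y * y powr (-\<alpha>) = y powr (1 - \<alpha>)"
    using y by (simp add: powr_diff powr_minus field_simps)
  finally show ?thesis by (simp add: w_def)
qed

lemma scaled_Q_tendsto:
  assumes m: "(\<lambda>i. real (m i) / real i) \<longlonglongrightarrow> y" and y: "y > 0"
  shows "(\<lambda>i. w i * Q (m i)) \<longlonglongrightarrow> c * y powr (\<alpha> - 1)"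
proof -
  have "filterlim (\<lambda>i. real (m i) / real i * real i) at_top sequentially"
    by (rule filterlim_tendsto_pos_mult_at_top[OF m y filterlim_real_sequentially])
  also have "?this \<longleftrightarrow> filterlim (\<lambda>i. real (m i)) at_top sequentially"
    by (intro filterlim_cong refl eventually_mono[OF eventually_gt_at_top[of 0]]) auto
  finally have lim: "filterlim m sequentially sequentially"
    by (simp add: filterlim_sequentially_iff_filterlim_real)
  have "(\<lambda>i. Q (m i) * w (m i) / (w (m i) / w i)) \<longlonglongrightarrow> c / y powr (1 - \<alpha>)"
    using y by (intro tendsto_divide w_ratio_tendsto m
        filterlim_compose[OF Q_limit[folded w_def] lim]) auto
  also have "c / y powr (1 - \<alpha>) = c * y powr (\<alpha> - 1)"
    using powr_minus_divide[of y "1 - \<alpha>"] by simp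
  also have "(\<lambda>i. Q (m i) * w (m i) / (w (m i) / w i)) \<longlonglongrightarrow> c * y powr (\<alpha> - 1) \<longleftrightarrow> ?thesis"
  proof (rule tendsto_cong)
    show "eventually (\<lambda>i. Q (m i) * w (m i) / (w (m i) / w i) = w i * Q (m i)) sequentially"
      using eventually_gt_at_top[of 0] filterlim_at_top[THEN iffD1, OF lim, rule_format, of 1]
    proof eventually_elim
      case (elim i)
      show ?case using w_pos[of i] w_pos[of "m i"] elim by simp
    qed
  qed
  finally show ?thesis .
qed

text \<open>
  The shift by one avoids a separate treatment of n = 0, where w vanishes, and makes the bound
  compatible with floor (i x) + 1 \<ge> i x.
\<close>

lemma Q_bound: "\<exists>B>0. \<forall>n. Q n \<le> B / w (n + 1)"
proof -
  have one: "(\<lambda>n. real (n + 1) / real n) \<longlonglongrightarrow> 1" by real_asymp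
  have "(\<lambda>n. Q n * w n * (w (n + 1) / w n)) \<longlonglongrightarrow> c * 1 powr (1 - \<alpha>)"
    by (intro tendsto_mult Q_limit[folded w_def] w_ratio_tendsto one) auto
  also have "?this \<longleftrightarrow> (\<lambda>n. Q n * w (n + 1)) \<longlonglongrightarrow> c * 1 powr (1 - \<alpha>)"
  proof (rule tendsto_cong)
    show "eventually (\<lambda>n. Q n * w n * (w (n + 1) / w n) = Q n * w (n + 1)) sequentially"
      using eventually_gt_at_top[of 0]
      by eventually_elim (use w_pos in \<open>auto simp: less_imp_neq[symmetric] Suc_le_eq\<close>)
  qed
  finally have "Bseq (\<lambda>n. Q n * w (n + 1))"
    by (intro convergent_imp_Bseq) (auto simp: convergent_def)
  then obtain B where B: "B > 0" "\<And>n. norm (Q n * w (n + 1)) \<le> B"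
    by (auto simp: Bseq_def)
  have "Q n \<le> B / w (n + 1)" for n
    using B(2)[of n] Q_nonneg[of n] w_pos[of "n + 1"] by (simp add: field_simps abs_mult)
  thus ?thesis using B(1) by blast
qed

text \<open>
  The two exponents cover j \<ge> i and j \<le> i; keeping their sum avoids case distinctions later.
\<close>

lemma w_ratio_bound:
  assumes \<epsilon>: "\<epsilon> > 0" "\<epsilon> < \<alpha>"
  shows "\<exists>C>0. \<forall>i\<ge>1. \<forall>j\<ge>1. w i / w j \<le>
           C * ((real j / real i) powr (\<alpha> + \<epsilon> - 1) + (real j / real i) powr (\<alpha> - \<epsilon> - 1))"
proof -
  obtain C1 where C1: "C1 > 0"
    "\<And>n m. n \<ge> 1 \<Longrightarrow> m \<ge> n \<Longrightarrow> real n powr (\<alpha> + \<epsilon>) * T n \<le> C1 * (real m powr (\<alpha> + \<epsilon>) * T m)"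
    using potter_lower[OF \<epsilon>(1)] by blast
  obtain C2 where C2: "C2 > 0"
    "\<And>n m. n \<ge> 1 \<Longrightarrow> m \<ge> n \<Longrightarrow> real m powr (\<alpha> - \<epsilon>) * T m \<le> C2 * (real n powr (\<alpha> - \<epsilon>) * T n)"
    using potter_upper[OF \<epsilon>] by blast
  have key: "w i / w j \<le> D * (real j / real i) powr (e - 1)"
    if "i \<ge> 1" "j \<ge> 1" and le: "real i powr e * T i \<le> D * (real j powr e * T j)" for i j D e
  proof -
    have ij: "real i > 0" "real j > 0" using that by auto
    have "T i / T j \<le> D * (real j powr e / real i powr e)"
      using le T_pos[of j] ij by (simp add: field_simps)
    hence "real i / real j * (T i / T j) \<le> real i / real j * (D * (real j powr e / real i powr e))"
      by (intro mult_left_mono) auto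
    also have "\<dots> = D * (real j / real i) powr (e - 1)"
      using ij by (simp add: powr_diff powr_divide field_simps)
    finally show ?thesis by (simp add: w_def)
  qed
  show ?thesis
  proof (intro exI[of _ "max C1 C2"] conjI allI impI)
    show "max C1 C2 > 0" using C1(1) by simp
    fix i j :: nat assume ij: "1 \<le> i" "1 \<le> j"
    define X Y where "X = (real j / real i) powr (\<alpha> + \<epsilon> - 1)" and "Y = (real j / real i) powr (\<alpha> - \<epsilon> - 1)"
    have XY: "X \<ge> 0" "Y \<ge> 0" by (auto simp: X_def Y_def)
    have "w i / w j \<le> max C1 C2 * X \<or> w i / w j \<le> max C1 C2 * Y"
    proof (cases "i \<le> j")
      case True
      have "w i / w j \<le> C1 * X" unfolding X_def by (intro key C1 ij True)
      also have "\<dots> \<le> max C1 C2 * X" using XY by (intro mult_right_mono) auto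
      finally show ?thesis by simp
    next
      case False
      have "w i / w j \<le> C2 * Y" unfolding Y_def using False by (intro key C2 ij) auto
      also have "\<dots> \<le> max C1 C2 * Y" using XY by (intro mult_right_mono) auto
      finally show ?thesis by simp
    qed
    moreover have "max C1 C2 * X \<ge> 0" "max C1 C2 * Y \<ge> 0" using XY C1(1) by auto
    ultimately show "w i / w j \<le> max C1 C2 * (X + Y)" by (auto simp: distrib_left)
  qed
qed

text \<open>
  A step function in x whose integral is the i-th correlation of Q times w i ^ 2 / i.
\<close>

definition rescaled :: "nat \<Rightarrow> real \<Rightarrow> real" where
  "rescaled i x = indicator {0..} x *
     ((w i * Q (nat \<lfloor>real i * x\<rfloor>)) * (w i * Q (nat \<lfloor>real i * x\<rfloor> + i)))"

lemma rescaled_nonneg: "rescaled i x \<ge> 0"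
  using Q_nonneg w_nonneg by (simp add: rescaled_def)

lemma rescaled_measurable [measurable]: "rescaled i \<in> borel_measurable borel"
  unfolding rescaled_def by measurable

lemma rescaled_tendsto:
  assumes x: "x > 0"
  shows "(\<lambda>i. rescaled i x) \<longlonglongrightarrow> c\<^sup>2 * (x powr (\<alpha> - 1) * (1 + x) powr (\<alpha> - 1))"
proof -
  define m where "m i = nat \<lfloor>real i * x\<rfloor>" for i
  have m_real: "real (m i) = of_int \<lfloor>real i * x\<rfloor>" for i
    using x by (simp add: m_def)
  have m1: "(\<lambda>i. real (m i) / real i) \<longlonglongrightarrow> x"
    unfolding m_real using x by real_asymp
  have "(\<lambda>i. real (m i) / real i + real i / real i) \<longlonglongrightarrow> x + 1"
    by (rule tendsto_add[OF m1]) real_asymp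
  hence m2: "(\<lambda>i. real (m i + i) / real i) \<longlonglongrightarrow> 1 + x"
    by (simp add: add_divide_distrib add.commute)
  have "(\<lambda>i. (w i * Q (m i)) * (w i * Q (m i + i))) \<longlonglongrightarrow> (c * x powr (\<alpha> - 1)) * (c * (1 + x) powr (\<alpha> - 1))"
    using x by (intro tendsto_mult[of "\<lambda>i. w i * Q (m i)"] scaled_Q_tendsto m1 m2) auto
  thus ?thesis using x by (simp add: rescaled_def m_def power2_eq_square mult_ac)
qed

text \<open>
  With d = \<alpha> + \<epsilon> - 1 and e = \<alpha> - \<epsilon> - 1 the majorant is a multiple of (x powr d + x powr e) * (1 + x) powr d, a
  sum of two integrands of beta_prime_integral. Integrability at infinity needs 2 * d < -1, which
  some \<epsilon> > 0 satisfies because \<alpha> < 1/2; integrability at 0 needs e > -1, that is, \<epsilon> < \<alpha>.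
\<close>

lemma rescaled_dominated:
  obtains h where "integrable lborel h" "\<And>i x. i \<ge> 1 \<Longrightarrow> x > 0 \<Longrightarrow> rescaled i x \<le> h x"
proof -
  \<comment> \<open>Half of the largest value that both integrability constraints allow.\<close>
  define \<epsilon> where "\<epsilon> = min \<alpha> (1 / 2 - \<alpha>) / 2"
  have \<epsilon>: "0 < \<epsilon>" "\<epsilon> < \<alpha>" "\<alpha> + \<epsilon> < 1 / 2"
    using index_pos index_less by (auto simp: \<epsilon>_def min_def)
  define d e where "d = \<alpha> + \<epsilon> - 1" and "e = \<alpha> - \<epsilon> - 1"
  have de: "e \<le> d" "d < 0" "e < 0" using \<epsilon> by (auto simp: d_def e_def)
  obtain B where B: "B > 0" "\<And>n. Q n \<le> B / w (n + 1)" using Q_bound by blast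
  obtain C where C: "C > 0" "\<And>i j. i \<ge> 1 \<Longrightarrow> j \<ge> 1 \<Longrightarrow>
      w i / w j \<le> C * ((real j / real i) powr d + (real j / real i) powr e)"
    using w_ratio_bound[OF \<epsilon>(1,2)] unfolding d_def e_def by blast
  have wQ: "w i * Q n \<le> B * C * (y powr d + y powr e)"
    if "i \<ge> 1" "0 < y" "y \<le> real (n + 1) / real i" for i n y
  proof -
    have "w i * Q n \<le> w i * (B / w (n + 1))" by (intro mult_left_mono B w_nonneg)
    also have "\<dots> = B * (w i / w (n + 1))" by simp
    also have "\<dots> \<le> B * (C * ((real (n + 1) / real i) powr d + (real (n + 1) / real i) powr e))"
      using B(1) that by (intro mult_left_mono C) auto
    also have "\<dots> \<le> B * (C * (y powr d + y powr e))"
      using B(1) C(1) that de by (intro mult_left_mono add_mono powr_mono2') auto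
    finally show ?thesis by (simp add: mult.assoc)
  qed
  define f where "f a b x = indicator {0<..} x * (x powr (a - 1) * (1 + x) powr (-(a + b)))" for a b x :: real
  define h where "h x = 2 * (B * C)\<^sup>2 * (f (\<alpha> + \<epsilon>) (1 - 2 * \<alpha> - 2 * \<epsilon>) x + f (\<alpha> - \<epsilon>) (1 - 2 * \<alpha>) x)" for x
  show thesis
  proof
    have "integrable lborel (f (\<alpha> + \<epsilon>) (1 - 2 * \<alpha> - 2 * \<epsilon>))" "integrable lborel (f (\<alpha> - \<epsilon>) (1 - 2 * \<alpha>))"
      unfolding f_def using \<epsilon> by (intro beta_prime_integral; simp)+
    thus "integrable lborel h" unfolding h_def by auto
    fix i :: nat and x :: real assume i: "i \<ge> 1" and x: "x > 0"
    have fl: "real i * x \<le> real (nat \<lfloor>real i * x\<rfloor> + 1)"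
    proof -
      have "real i * x \<ge> 0" using x by simp
      thus ?thesis by linarith
    qed
    have "w i * Q (nat \<lfloor>real i * x\<rfloor>) \<le> B * C * (x powr d + x powr e)"
      using fl i x by (intro wQ) (auto simp: field_simps)
    moreover have "w i * Q (nat \<lfloor>real i * x\<rfloor> + i) \<le> B * C * ((1 + x) powr d + (1 + x) powr e)"
      using fl i x by (intro wQ) (auto simp: field_simps)
    ultimately have "rescaled i x \<le> (B * C * (x powr d + x powr e)) * (B * C * ((1 + x) powr d + (1 + x) powr e))"
      using x B(1) C(1) by (simp only: rescaled_def) (rule order_trans[OF _ mult_mono], auto intro!: mult_nonneg_nonneg add_nonneg_nonneg w_nonneg Q_nonneg simp: less_imp_le indicator_def)
    also have "\<dots> \<le> (B * C * (x powr d + x powr e)) * (B * C * ((1 + x) powr d + (1 + x) powr d))"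
      using x B(1) C(1) de by (intro mult_left_mono add_left_mono powr_mono) (auto intro!: add_nonneg_nonneg)
    also have "\<dots> = h x"
    proof -
      have "f (\<alpha> + \<epsilon>) (1 - 2 * \<alpha> - 2 * \<epsilon>) x = x powr d * (1 + x) powr d"
           "f (\<alpha> - \<epsilon>) (1 - 2 * \<alpha>) x = x powr e * (1 + x) powr d"
        using x by (simp_all add: f_def d_def e_def algebra_simps)
      thus ?thesis by (simp add: h_def power2_eq_square algebra_simps)
    qed
    finally show "rescaled i x \<le> h x" .
  qed
qed

lemma rescaled_integral:
  "eventually (\<lambda>i. integrable lborel (rescaled i)) sequentially"
  "(\<lambda>i. integral\<^sup>L lborel (rescaled i)) \<longlonglongrightarrow> c\<^sup>2 * Beta \<alpha> (1 - 2 * \<alpha>)"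
proof -
  obtain h where h: "integrable lborel h" "\<And>i x. i \<ge> 1 \<Longrightarrow> x > 0 \<Longrightarrow> rescaled i x \<le> h x"
    using rescaled_dominated by blast
  have nz: "AE x in lborel. x \<noteq> (0::real)" by (rule AE_lborel_singleton)
  have bound: "AE x in lborel. norm (rescaled i x) \<le> norm (h x)" if "i \<ge> 1" for i
    using nz
  proof eventually_elim
    case (elim x)
    show ?case
    proof (cases "x > 0")
      case True
      thus ?thesis using h(2)[OF that True] rescaled_nonneg[of i x] by simp
    next
      case False
      thus ?thesis using elim by (simp add: rescaled_def)
    qed
  qed
  have int: "integrable lborel (rescaled i)" if "i \<ge> 1" for i
    by (rule Bochner_Integration.integrable_bound[OF h(1) _ bound[OF that]]) simp
  thus "eventually (\<lambda>i. integrable lborel (rescaled i)) sequentially"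
    by (intro eventually_mono[OF eventually_ge_at_top[of 1]])
  define f where "f x = indicator {0<..} x * (x powr (\<alpha> - 1) * (1 + x) powr (-(\<alpha> + (1 - 2 * \<alpha>))))" for x
  have f: "integral\<^sup>L lborel f = Beta \<alpha> (1 - 2 * \<alpha>)" "integrable lborel f"
    unfolding f_def using index_pos index_less by (intro beta_prime_integral; simp)+
  have "(\<lambda>i. integral\<^sup>L lborel (rescaled (Suc i))) \<longlonglongrightarrow> integral\<^sup>L lborel (\<lambda>x. c\<^sup>2 * f x)"
  proof (rule integral_dominated_convergence)
    show "integrable lborel (\<lambda>x. norm (h x))" using h(1) by simp
    show "AE x in lborel. norm (rescaled (Suc i) x) \<le> norm (h x)" for i by (rule bound) simp
    show "(\<lambda>x. c\<^sup>2 * f x) \<in> borel_measurable lborel" using f(2) by simp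
    show "AE x in lborel. (\<lambda>i. rescaled (Suc i) x) \<longlonglongrightarrow> c\<^sup>2 * f x"
      using nz
    proof eventually_elim
      case (elim x)
      show ?case
      proof (cases "x > 0")
        case True
        have "f x = x powr (\<alpha> - 1) * (1 + x) powr (\<alpha> - 1)" using True by (simp add: f_def)
        thus ?thesis using LIMSEQ_Suc[OF rescaled_tendsto[OF True]] by simp
      qed (use elim in \<open>simp add: rescaled_def f_def\<close>)
    qed
  qed simp_all
  hence "(\<lambda>i. integral\<^sup>L lborel (rescaled (Suc i))) \<longlonglongrightarrow> c\<^sup>2 * Beta \<alpha> (1 - 2 * \<alpha>)"
    by (simp add: f)
  thus "(\<lambda>i. integral\<^sup>L lborel (rescaled i)) \<longlonglongrightarrow> c\<^sup>2 * Beta \<alpha> (1 - 2 * \<alpha>)"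
    by (rule LIMSEQ_imp_Suc)
qed

lemma correlation_eventually:
  "eventually (\<lambda>i. summable (\<lambda>m. Q m * Q (m + i)) \<and>
     (\<Sum>m. Q m * Q (m + i)) * (real i * (T i)\<^sup>2) = integral\<^sup>L lborel (rescaled i)) sequentially"
  using rescaled_integral(1) eventually_gt_at_top[of 0]
proof eventually_elim
  case (elim i)
  define F where "F m = (w i * Q m) * (w i * Q (m + i))" for m
  have F: "F m \<ge> 0" for m using Q_nonneg w_nonneg by (simp add: F_def)
  have "(\<integral>\<^sup>+x. ennreal (rescaled i x) \<partial>lborel)
          = (\<integral>\<^sup>+x. indicator {0..} x * ennreal (F (nat \<lfloor>real i * x\<rfloor>)) \<partial>lborel)"
    by (intro nn_integral_cong) (simp add: rescaled_def F_def indicator_def)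
  also have "\<dots> = (\<Sum>m. ennreal (F m)) * ennreal (1 / real i)"
    by (rule nn_integral_of_nat_floor) fact
  finally have eq: "ennreal (integral\<^sup>L lborel (rescaled i)) = (\<Sum>m. ennreal (F m)) * ennreal (1 / real i)"
    by (subst nn_integral_eq_integral[symmetric]) (use elim rescaled_nonneg in auto)
  hence "(\<Sum>m. ennreal (F m)) \<noteq> top"
    using elim by (auto simp: ennreal_top_mult)
  hence sF: "summable F" using F by (intro summable_suminf_not_top) auto
  have wi: "w i > 0" using elim w_pos by simp
  have QF: "Q m * Q (m + i) = F m / (w i)\<^sup>2" for m
    using wi by (simp add: F_def power2_eq_square)
  have "(\<Sum>m. ennreal (F m)) * ennreal (1 / real i) = ennreal (suminf F / real i)"
    using F sF by (simp add: suminf_ennreal2 ennreal_mult'[symmetric] suminf_nonneg)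
  hence "integral\<^sup>L lborel (rescaled i) = suminf F / real i"
    using eq F sF by (simp add: suminf_nonneg rescaled_nonneg)
  moreover have "summable (\<lambda>m. Q m * Q (m + i))" unfolding QF using sF by simp
  moreover have "(\<Sum>m. Q m * Q (m + i)) = suminf F / (w i)\<^sup>2"
    unfolding QF using sF by (simp add: suminf_divide)
  moreover have "suminf F / (w i)\<^sup>2 * (real i * (T i)\<^sup>2) = suminf F / real i"
    using elim T_pos[of i] by (simp add: w_def power2_eq_square)
  ultimately show ?case by simp
qed

lemma correlation_asymptotics:
  "(\<lambda>i. (\<Sum>m. Q m * Q (m + i)) * (real i * (T i)\<^sup>2)) \<longlonglongrightarrow> c\<^sup>2 * Beta \<alpha> (1 - 2 * \<alpha>)"
  by (rule Lim_transform_eventually[OF rescaled_integral(2)])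
     (use correlation_eventually in eventually_elim, simp)

text \<open>
  The integral representation yields summability of Q m * Q (m + i) for some i; since Q varies regularly,
  Q m and Q (m + i) are comparable for large m.
\<close>

lemma Q_square_summable: "summable (\<lambda>m. (Q m)\<^sup>2)"
proof -
  obtain i where i: "i \<ge> 1" "summable (\<lambda>m. Q m * Q (m + i))"
    using eventually_conj[OF correlation_eventually eventually_ge_at_top[of 1]]
    by (auto simp: eventually_sequentially)
  have "(\<lambda>m. real m / real m) \<longlonglongrightarrow> 1" "(\<lambda>m. real (m + i) / real m) \<longlonglongrightarrow> 1" by real_asymp+
  hence "(\<lambda>m. (w m * Q m) / (w m * Q (m + i))) \<longlonglongrightarrow> (c * 1 powr (\<alpha> - 1)) / (c * 1 powr (\<alpha> - 1))"
    using c_pos by (intro tendsto_divide scaled_Q_tendsto) auto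
  hence "eventually (\<lambda>m. (w m * Q m) / (w m * Q (m + i)) < 2) sequentially"
    using c_pos by (intro order_tendstoD) auto
  moreover have "(\<lambda>m. w m * Q (m + i)) \<longlonglongrightarrow> c * 1 powr (\<alpha> - 1)"
    by (rule scaled_Q_tendsto) (real_asymp, simp)
  hence "eventually (\<lambda>m. w m * Q (m + i) > 0) sequentially"
    using c_pos by (intro order_tendstoD) auto
  ultimately have "eventually (\<lambda>m. norm ((Q m)\<^sup>2) \<le> 2 * (Q m * Q (m + i))) sequentially"
    using eventually_ge_at_top[of 1]
  proof eventually_elim
    case (elim m)
    have "w m > 0" using elim by (intro w_pos)
    hence "Q m \<le> 2 * Q (m + i)" using elim(1,2) by (simp add: field_simps zero_less_mult_iff)
    hence "Q m * Q m \<le> Q m * (2 * Q (m + i))" by (intro mult_left_mono Q_nonneg)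
    thus ?case by (simp add: power2_eq_square mult_ac)
  qed
  thus ?thesis
    by (rule summable_comparison_test_ev) (use i in auto)
qed

text \<open>
  By the Potter bound, i * (T i)^2 is at least of order i powr (1 - 2 * (\<alpha> + \<epsilon>)), which tends to infinity
  for small \<epsilon>.
\<close>

lemma correlation_tendsto_0: "(\<lambda>i. \<Sum>m. Q m * Q (m + i)) \<longlonglongrightarrow> 0"
proof -
  define \<epsilon> where "\<epsilon> = (1 / 2 - \<alpha>) / 2"
  have \<epsilon>: "\<epsilon> > 0" "2 * (\<alpha> + \<epsilon>) < 1" using index_less by (auto simp: \<epsilon>_def field_simps)
  obtain C where C: "C > 0"
    "\<And>n m. n \<ge> 1 \<Longrightarrow> m \<ge> n \<Longrightarrow> real n powr (\<alpha> + \<epsilon>) * T n \<le> C * (real m powr (\<alpha> + \<epsilon>) * T m)"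
    using potter_lower[OF \<epsilon>(1)] by blast
  define D where "D = (T 1 / C)\<^sup>2"
  have D: "D > 0" using C(1) T_pos[of 1] by (simp add: D_def)
  have low: "D * real i powr (1 - 2 * (\<alpha> + \<epsilon>)) \<le> real i * (T i)\<^sup>2" if "i \<ge> 1" for i
  proof -
    have "T 1 / C \<le> real i powr (\<alpha> + \<epsilon>) * T i"
      using C(2)[of 1 i] that C(1) by (simp add: field_simps)
    hence "D \<le> (real i powr (\<alpha> + \<epsilon>) * T i)\<^sup>2"
      unfolding D_def using C(1) T_pos[of 1] by (intro power_mono) auto
    also have "\<dots> = real i powr (2 * (\<alpha> + \<epsilon>)) * (T i)\<^sup>2"
      using that by (simp add: power_mult_distrib power2_eq_square powr_add[symmetric])
    finally have "D * real i powr (1 - 2 * (\<alpha> + \<epsilon>)) \<le> 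
        real i powr (2 * (\<alpha> + \<epsilon>)) * (T i)\<^sup>2 * real i powr (1 - 2 * (\<alpha> + \<epsilon>))"
      by (intro mult_right_mono) auto
    also have "\<dots> = (real i powr (2 * (\<alpha> + \<epsilon>)) * real i powr (1 - 2 * (\<alpha> + \<epsilon>))) * (T i)\<^sup>2"
      by (simp only: mult_ac)
    also have "real i powr (2 * (\<alpha> + \<epsilon>)) * real i powr (1 - 2 * (\<alpha> + \<epsilon>)) = real i"
      using that by (simp add: powr_add[symmetric])
    finally show ?thesis .
  qed
  have "filterlim (\<lambda>i. D * real i powr (1 - 2 * (\<alpha> + \<epsilon>))) at_top sequentially"
    using D \<epsilon> by real_asymp
  hence "filterlim (\<lambda>i. real i * (T i)\<^sup>2) at_top sequentially"
    by (rule filterlim_at_top_mono) (intro eventually_mono[OF eventually_ge_at_top[of 1]] low)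
  hence "(\<lambda>i. (\<Sum>m. Q m * Q (m + i)) * (real i * (T i)\<^sup>2) / (real i * (T i)\<^sup>2)) \<longlonglongrightarrow> 0"
    by (intro real_tendsto_divide_at_top[OF correlation_asymptotics])
  thus ?thesis
    by (rule Lim_transform_eventually)
       (use eventually_gt_at_top[of 0] in eventually_elim, use T_pos in \<open>auto simp: less_imp_neq[symmetric]\<close>)
qed

end

section \<open>Renewal weights\<close>

lemma sets_renewal_event:
  "{x. \<exists>j. (\<Sum>k<j. x k) = (n::nat)} \<in> sets (\<Pi>\<^sub>M k\<in>(UNIV :: nat set). measure_pmf \<mu>)"
proof -
  have [measurable]: "(\<lambda>x. x k) \<in> measurable (\<Pi>\<^sub>M k\<in>(UNIV :: nat set). measure_pmf \<mu>) (count_space UNIV)" for k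
    using measurable_component_singleton[of k UNIV "\<lambda>_. measure_pmf \<mu>"]
    by (simp cong: measurable_cong_sets)
  have "Measurable.pred (\<Pi>\<^sub>M k\<in>(UNIV :: nat set). measure_pmf \<mu>) (\<lambda>x. \<exists>j. (\<Sum>k<j. real (x k)) = real n)"
    by measurable
  thus ?thesis
    by (simp add: pred_def space_PiM of_nat_sum[symmetric] del: of_nat_sum)
qed

lemma renewal_weight_nonneg: "renewal_weight \<mu> n \<ge> 0"
  by (simp add: renewal_weight_def)

lemma prob_space_sequences: "prob_space (\<Pi>\<^sub>M k\<in>(UNIV :: nat set). measure_pmf \<mu>)"
  by (intro prob_space_PiM prob_space_measure_pmf)

lemma renewal_weight_le_1: "renewal_weight \<mu> n \<le> 1"
  unfolding renewal_weight_def by (rule prob_space.prob_le_1[OF prob_space_sequences])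

lemma renewal_weight_0: "renewal_weight \<mu> 0 = 1"
proof -
  have "{x. \<exists>j. (\<Sum>k<j. x k) = (0::nat)} = space (\<Pi>\<^sub>M k\<in>(UNIV :: nat set). measure_pmf \<mu>)"
    by (auto simp: space_PiM intro: exI[of _ "0::nat"])
  thus ?thesis unfolding renewal_weight_def
    by (simp add: prob_space.prob_space[OF prob_space_sequences])
qed

text \<open>
  Condition on the first step: prepending an independent \<mu>-distributed value to an i.i.d. sequence gives an i.i.d.
  sequence again. A first step k > n makes the event impossible.
\<close>

lemma renewal_weight_recurrence:
  assumes n: "n \<ge> 1"
  shows "renewal_weight \<mu> n =
    measure_pmf.expectation \<mu> (\<lambda>k. if k \<le> n then renewal_weight \<mu> (n - k) else 0)"
proof -
  interpret sequence_space "measure_pmf \<mu>"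
    by (intro sequence_space.intro product_prob_spaceI prob_space_measure_pmf)
  define ev where "ev n = {x::nat \<Rightarrow> nat. \<exists>j. (\<Sum>k<j. x k) = n}" for n
  have ev [measurable]: "ev n \<in> sets S" for n unfolding ev_def by (rule sets_renewal_event)
  have shift: "(case_nat k x \<in> ev n) = (k \<le> n \<and> x \<in> ev (n - k))" for k x
  proof -
    have "case_nat k x \<in> ev n \<longleftrightarrow> (\<exists>j. (\<Sum>l<Suc j. case_nat k x l) = n)"
      unfolding ev_def mem_Collect_eq using n
      by (intro iffI; elim exE) (metis lessThan_0 not_one_le_zero old.nat.exhaust sum.empty, blast)
    also have "\<dots> \<longleftrightarrow> (\<exists>j. k + (\<Sum>l<j. x l) = n)"
      by (simp add: sum.lessThan_Suc_shift del: sum.lessThan_Suc)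
    also have "\<dots> \<longleftrightarrow> k \<le> n \<and> x \<in> ev (n - k)"
      unfolding ev_def mem_Collect_eq by (metis add_diff_cancel_left' le_add1 le_add_diff_inverse)
    finally show ?thesis .
  qed
  have f [measurable]: "(\<lambda>(s, x). case_nat s x) \<in> measurable (measure_pmf \<mu> \<Otimes>\<^sub>M S) S"
    by measurable
  have "emeasure S (ev n) = emeasure (distr (measure_pmf \<mu> \<Otimes>\<^sub>M S) S (\<lambda>(s, x). case_nat s x)) (ev n)"
    by (simp only: PiM_iter)
  also have "\<dots> = emeasure (measure_pmf \<mu> \<Otimes>\<^sub>M S) ((\<lambda>(s, x). case_nat s x) -` ev n \<inter> space (measure_pmf \<mu> \<Otimes>\<^sub>M S))"
    by (rule emeasure_distr) measurable
  also have "\<dots> = (\<integral>\<^sup>+k. emeasure S (Pair k -` ((\<lambda>(s, x). case_nat s x) -` ev n \<inter> space (measure_pmf \<mu> \<Otimes>\<^sub>M S))) \<partial>\<mu>)"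
    by (rule P.emeasure_pair_measure_alt)
       (rule measurable_sets[OF f ev])
  also have "\<dots> = (\<integral>\<^sup>+k. ennreal (if k \<le> n then renewal_weight \<mu> (n - k) else 0) \<partial>\<mu>)"
  proof (rule nn_integral_cong)
    fix k
    have "Pair k -` ((\<lambda>(s, x). case_nat s x) -` ev n \<inter> space (measure_pmf \<mu> \<Otimes>\<^sub>M S)) = (if k \<le> n then ev (n - k) else {})"
      by (auto simp: shift space_pair_measure space_PiM)
    thus "emeasure S (Pair k -` ((\<lambda>(s, x). case_nat s x) -` ev n \<inter> space (measure_pmf \<mu> \<Otimes>\<^sub>M S))) =
            ennreal (if k \<le> n then renewal_weight \<mu> (n - k) else 0)"
      by (simp add: P.emeasure_eq_measure renewal_weight_def ev_def)
  qed
  also have "\<dots> = ennreal (measure_pmf.expectation \<mu> (\<lambda>k. if k \<le> n then renewal_weight \<mu> (n - k) else 0))"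
    by (intro nn_integral_eq_integral measure_pmf.integrable_const_bound[where B = 1])
       (auto simp: renewal_weight_nonneg renewal_weight_le_1)
  finally show ?thesis
    unfolding P.emeasure_eq_measure
    by (subst (asm) ennreal_inj) (auto simp: renewal_weight_def ev_def intro!: Bochner_Integration.integral_nonneg)
qed

section \<open>The distance chain and its hitting probability\<close>

lemma integrable_pmf_bounded:
  fixes f :: "'a \<Rightarrow> real"
  assumes "\<And>x. \<bar>f x\<bar> \<le> B"
  shows "integrable (measure_pmf \<mu>) f"
  by (rule measure_pmf.integrable_const_bound[where B = B]) (use assms in auto)

text \<open>
  The probability that the Markov chain d \<mapsto> |d - k|, with k drawn from \<mu>, hits 0 within n steps
  when started at d.
\<close>

primrec meeting_prob :: "nat pmf \<Rightarrow> nat \<Rightarrow> nat \<Rightarrow> real" where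
  "meeting_prob \<mu> 0 d = of_bool (d = 0)"
| "meeting_prob \<mu> (Suc n) d = (if d = 0 then 1 else
     measure_pmf.expectation \<mu> (\<lambda>k. meeting_prob \<mu> n (nat \<bar>int d - int k\<bar>)))"

lemma meeting_prob_range: "0 \<le> meeting_prob \<mu> n d \<and> meeting_prob \<mu> n d \<le> 1"
proof (induction n arbitrary: d)
  case (Suc n)
  have "measure_pmf.expectation \<mu> (\<lambda>k. meeting_prob \<mu> n (nat \<bar>int d - int k\<bar>)) \<le> 1"
    using Suc by (intro measure_pmf.integral_le_const integrable_pmf_bounded[where B = 1]) auto
  thus ?case using Suc by (auto intro!: Bochner_Integration.integral_nonneg)
qed auto

lemma integrable_meeting_prob: "integrable (measure_pmf \<nu>) (\<lambda>k. meeting_prob \<mu> n (f k))"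
  using meeting_prob_range by (intro integrable_pmf_bounded[where B = 1]) auto

lemma meeting_prob_mono: "meeting_prob \<mu> n d \<le> meeting_prob \<mu> (Suc n) d"
proof (induction n arbitrary: d)
  case 0
  show ?case using meeting_prob_range[of \<mu> "Suc 0" d] by (cases "d = 0") auto
next
  case (Suc n)
  have "measure_pmf.expectation \<mu> (\<lambda>k. meeting_prob \<mu> n (nat \<bar>int d - int k\<bar>)) \<le>
        measure_pmf.expectation \<mu> (\<lambda>k. meeting_prob \<mu> (Suc n) (nat \<bar>int d - int k\<bar>))"
    by (intro integral_mono integrable_meeting_prob Suc)
  thus ?case
    by (simp only: meeting_prob.simps(2)[of \<mu> "Suc n" d] meeting_prob.simps(2)[of \<mu> n d]) auto
qed

locale square_summable_renewal =
  fixes \<mu> :: "nat pmf" and Q :: "nat \<Rightarrow> real"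
  assumes Q_zero: "Q 0 = 1"
    and weights_nonneg: "Q n \<ge> 0"
    and Q_le_1: "Q n \<le> 1"
    and Q_recurrence: "n \<ge> 1 \<Longrightarrow> Q n = measure_pmf.expectation \<mu> (\<lambda>k. if k \<le> n then Q (n - k) else 0)"
    and weights_square_summable: "summable (\<lambda>m. (Q m)\<^sup>2)"
begin

definition correlation :: "nat \<Rightarrow> real" where
  "correlation d = (\<Sum>m. Q m * Q (m + d))"

lemma correlation_summand_le: "Q m * Q (m + d) \<le> ((Q m)\<^sup>2 + (Q (m + d))\<^sup>2) / 2"
  using sum_squares_bound[of "Q m" "Q (m + d)"] by simp

lemma summable_shift: "summable (\<lambda>m. (Q (m + d))\<^sup>2)"
  using weights_square_summable by (subst summable_iff_shift)

lemma summable_correlation: "summable (\<lambda>m. Q m * Q (m + d))"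
proof (rule summable_comparison_test)
  show "\<exists>N. \<forall>m\<ge>N. norm (Q m * Q (m + d)) \<le> ((Q m)\<^sup>2 + (Q (m + d))\<^sup>2) / 2"
    using weights_nonneg correlation_summand_le by auto
  show "summable (\<lambda>m. ((Q m)\<^sup>2 + (Q (m + d))\<^sup>2) / 2)"
    by (intro summable_divide summable_add weights_square_summable summable_shift)
qed

lemma correlation_nonneg: "correlation d \<ge> 0"
  unfolding correlation_def by (intro suminf_nonneg summable_correlation mult_nonneg_nonneg weights_nonneg)

lemma correlation_0: "correlation 0 = (\<Sum>m. (Q m)\<^sup>2)"
  by (simp add: correlation_def power2_eq_square)

lemma correlation_le: "correlation d \<le> correlation 0"
proof -
  have shifted: "(\<Sum>m. (Q (m + d))\<^sup>2) \<le> (\<Sum>m. (Q m)\<^sup>2)"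
    using suminf_split_initial_segment[OF weights_square_summable, of d] sum_nonneg[of "{..<d}" "\<lambda>m. (Q m)\<^sup>2"]
    by simp
  have "correlation d \<le> (\<Sum>m. ((Q m)\<^sup>2 + (Q (m + d))\<^sup>2) / 2)"
    unfolding correlation_def
    by (intro suminf_le correlation_summand_le summable_correlation summable_divide summable_add
        weights_square_summable summable_shift)
  also have "(\<Sum>m. ((Q m)\<^sup>2 + (Q (m + d))\<^sup>2) / 2) = ((\<Sum>m. (Q m)\<^sup>2) + (\<Sum>m. (Q (m + d))\<^sup>2)) / 2"
    by (simp add: suminf_divide suminf_add[symmetric] summable_add weights_square_summable summable_shift)
  also have "\<dots> \<le> ((\<Sum>m. (Q m)\<^sup>2) + (\<Sum>m. (Q m)\<^sup>2)) / 2"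
    using shifted by simp
  finally show ?thesis by (simp add: correlation_0)
qed

lemma correlation_0_pos: "correlation 0 > 0"
proof -
  have "(Q 0)\<^sup>2 \<le> (\<Sum>m. (Q m)\<^sup>2)"
    using sum_le_suminf[OF weights_square_summable, of "{0}"] by simp
  thus ?thesis unfolding correlation_0 by (simp add: Q_zero)
qed

text \<open>
  The correlation is symmetric in the shift: a negative shift only moves the index of summation.
  Here Q is extended by 0 to negative arguments.
\<close>

lemma shifted_correlation_sums:
  "(\<lambda>m. Q m * (if int m + d \<ge> 0 then Q (nat (int m + d)) else 0)) sums correlation (nat \<bar>d\<bar>)"
proof (cases "d \<ge> 0")
  case True
  hence "nat (int m + d) = m + nat d" for m by simp
  thus ?thesis
    using summable_sums[OF summable_correlation[of "nat d"]] True by (simp add: correlation_def)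
next
  case False
  define e where "e = nat (- d)"
  define f where "f m = Q m * (if int m + d \<ge> 0 then Q (nat (int m + d)) else 0)" for m
  have d: "d = - int e" using False by (simp add: e_def)
  have "(\<lambda>m. f (m + e)) sums correlation e"
    using summable_sums[OF summable_correlation[of e]] by (simp add: f_def d correlation_def mult.commute)
  moreover have "(\<Sum>m<e. f m) = 0"
    by (rule sum.neutral) (auto simp: f_def d)
  ultimately have "f sums correlation e"
    by (subst (asm) sums_iff_shift) simp
  thus ?thesis unfolding f_def by (simp add: d)
qed

lemma integrable_correlation: "integrable (measure_pmf \<nu>) (\<lambda>k. correlation (f k))"
  using correlation_nonneg correlation_le
  by (intro integrable_pmf_bounded[where B = "correlation 0"]) auto

text \<open>
  Insert the renewal equation for the factor Q (m + d), which is available since d \<ge> 1, and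
  exchange summation and expectation.
\<close>

lemma correlation_harmonic:
  assumes d: "d \<ge> 1"
  shows "correlation d = measure_pmf.expectation \<mu> (\<lambda>k. correlation (nat \<bar>int d - int k\<bar>))"
proof -
  define P where "P z = (if z \<ge> 0 then Q (nat z) else 0)" for z :: int
  have P: "0 \<le> P z" "P z \<le> 1" for z using weights_nonneg Q_le_1 by (auto simp: P_def)
  have rec: "Q (m + d) = measure_pmf.expectation \<mu> (\<lambda>k. P (int m + (int d - int k)))" for m
  proof -
    have "(if k \<le> m + d then Q (m + d - k) else 0) = P (int m + (int d - int k))" for k
      by (auto simp: P_def nat_diff_distrib' of_nat_diff intro!: arg_cong[where f = Q])
    thus ?thesis using Q_recurrence[of "m + d"] d by simp
  qed
  have "ennreal (correlation d) = (\<Sum>m. ennreal (Q m * Q (m + d)))"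
    unfolding correlation_def
    by (intro suminf_ennreal2[symmetric] summable_correlation mult_nonneg_nonneg weights_nonneg)
  also have "\<dots> = (\<Sum>m. \<integral>\<^sup>+k. ennreal (Q m * P (int m + (int d - int k))) \<partial>\<mu>)"
  proof (rule suminf_cong)
    fix m
    have "(\<integral>\<^sup>+k. ennreal (Q m * P (int m + (int d - int k))) \<partial>\<mu>) = 
            ennreal (measure_pmf.expectation \<mu> (\<lambda>k. Q m * P (int m + (int d - int k))))"
      using P weights_nonneg Q_le_1
      by (intro nn_integral_eq_integral integrable_pmf_bounded[where B = 1])
         (auto simp: abs_mult intro!: mult_le_one)
    thus "ennreal (Q m * Q (m + d)) = (\<integral>\<^sup>+k. ennreal (Q m * P (int m + (int d - int k))) \<partial>\<mu>)"
      by (simp add: rec)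
  qed
  also have "\<dots> = (\<integral>\<^sup>+k. (\<Sum>m. ennreal (Q m * P (int m + (int d - int k)))) \<partial>\<mu>)"
    by (rule nn_integral_suminf[symmetric]) simp
  also have "\<dots> = (\<integral>\<^sup>+k. ennreal (correlation (nat \<bar>int d - int k\<bar>)) \<partial>\<mu>)"
  proof (rule nn_integral_cong)
    fix k
    show "(\<Sum>m. ennreal (Q m * P (int m + (int d - int k)))) = ennreal (correlation (nat \<bar>int d - int k\<bar>))"
      using shifted_correlation_sums[of "int d - int k"] P weights_nonneg
      unfolding P_def[symmetric] by (intro suminf_ennreal_eq) auto
  qed
  also have "\<dots> = ennreal (measure_pmf.expectation \<mu> (\<lambda>k. correlation (nat \<bar>int d - int k\<bar>)))"
    using correlation_nonneg by (intro nn_integral_eq_integral integrable_correlation) auto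
  finally show ?thesis
    by (subst (asm) ennreal_inj) (auto intro!: correlation_nonneg Bochner_Integration.integral_nonneg)
qed

text \<open>
  Minimality of the hitting probability among nonnegative harmonic functions that are 1 at 0.
\<close>

lemma meeting_prob_le: "meeting_prob \<mu> n d \<le> correlation d / correlation 0"
proof (induction n arbitrary: d)
  case 0
  show ?case using correlation_0_pos correlation_nonneg by simp
next
  case (Suc n)
  show ?case
  proof (cases "d = 0")
    case True
    thus ?thesis using correlation_0_pos by simp
  next
    case False
    have "meeting_prob \<mu> (Suc n) d = measure_pmf.expectation \<mu> (\<lambda>k. meeting_prob \<mu> n (nat \<bar>int d - int k\<bar>))"
      using False by simp
    also have "\<dots> \<le> measure_pmf.expectation \<mu> (\<lambda>k. correlation (nat \<bar>int d - int k\<bar>) / correlation 0)"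
      by (intro integral_mono integrable_meeting_prob Suc integrable_divide_zero integrable_correlation)
    finally have "meeting_prob \<mu> (Suc n) d \<le>
        measure_pmf.expectation \<mu> (\<lambda>k. correlation (nat \<bar>int d - int k\<bar>) / correlation 0)" .
    thus ?thesis using correlation_harmonic[of d] False by simp
  qed
qed

text \<open>
  The hitting probability p is harmonic off 0, so h = correlation / correlation 0 - p is as well.
  By meeting_prob_le it is nonnegative, and it vanishes at 0 and at infinity. The maximum
  principle at the largest maximiser i then excludes positive values: a jump k > 2 * i leads to the distance
  k - i > i.
\<close>

lemma meeting_prob_tendsto:
  assumes unbounded: "\<And>n. \<exists>k>n. k \<in> set_pmf \<mu>"
    and vanishing: "correlation \<longlonglongrightarrow> 0"
  shows "(\<lambda>n. meeting_prob \<mu> n d) \<longlonglongrightarrow> correlation d / correlation 0"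
proof -
  have "\<exists>l. (\<lambda>n. meeting_prob \<mu> n d) \<longlonglongrightarrow> l" for d
    using incseq_convergent[of "\<lambda>n. meeting_prob \<mu> n d" 1] meeting_prob_range meeting_prob_mono
    by (metis incseq_SucI)
  then obtain p where p: "\<And>d. (\<lambda>n. meeting_prob \<mu> n d) \<longlonglongrightarrow> p d" by metis
  have p_le: "p d \<le> correlation d / correlation 0" for d
    by (rule LIMSEQ_le_const2[OF p]) (use meeting_prob_le in auto)
  have p_nonneg: "p d \<ge> 0" for d
    by (rule LIMSEQ_le_const[OF p]) (use meeting_prob_range in auto)
  have p_le_1: "p d \<le> 1" for d
    by (rule LIMSEQ_le_const2[OF p]) (use meeting_prob_range in auto)
  have p_harmonic: "p d = measure_pmf.expectation \<mu> (\<lambda>k. p (nat \<bar>int d - int k\<bar>))" if "d \<ge> 1" for d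
  proof (rule LIMSEQ_unique)
    show "(\<lambda>n. meeting_prob \<mu> (Suc n) d) \<longlonglongrightarrow> p d" by (rule LIMSEQ_Suc[OF p])
    have "(\<lambda>n. measure_pmf.expectation \<mu> (\<lambda>k. meeting_prob \<mu> n (nat \<bar>int d - int k\<bar>)))
            \<longlonglongrightarrow> measure_pmf.expectation \<mu> (\<lambda>k. p (nat \<bar>int d - int k\<bar>))"
      by (rule integral_dominated_convergence[where w = "\<lambda>_. 1"]) (use p meeting_prob_range in auto)
    thus "(\<lambda>n. meeting_prob \<mu> (Suc n) d) \<longlonglongrightarrow> measure_pmf.expectation \<mu> (\<lambda>k. p (nat \<bar>int d - int k\<bar>))"
      using that by simp
  qed
  define h where "h d = correlation d / correlation 0 - p d" for d
  have h_nonneg: "h d \<ge> 0" for d using p_le by (simp add: h_def)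
  have h_le_1: "h d \<le> 1" for d
    using p_nonneg[of d] correlation_le[of d] correlation_0_pos by (simp add: h_def field_simps)
      (smt (verit) mult_nonneg_nonneg)
  have "(\<lambda>n. meeting_prob \<mu> n 0) = (\<lambda>n. 1)"
    by (rule ext, rename_tac n, case_tac n) auto
  hence "p 0 = 1" using p[of 0] by (simp add: LIMSEQ_const_iff)
  hence h_0: "h 0 = 0" using correlation_0_pos by (simp add: h_def)
  have h_harmonic: "h d = measure_pmf.expectation \<mu> (\<lambda>k. h (nat \<bar>int d - int k\<bar>))" if "d \<ge> 1" for d
  proof -
    have "integrable (measure_pmf \<mu>) (\<lambda>k. p (nat \<bar>int d - int k\<bar>))"
      using p_nonneg p_le_1 by (intro integrable_pmf_bounded[where B = 1]) auto
    thus ?thesis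
      unfolding h_def
      by (subst Bochner_Integration.integral_diff)
         (auto simp: integrable_correlation correlation_harmonic[OF that, symmetric] p_harmonic[OF that, symmetric])
  qed
  have "(\<lambda>d. correlation d / correlation 0) \<longlonglongrightarrow> 0"
    using tendsto_divide[OF vanishing tendsto_const[of "correlation 0"]] correlation_0_pos by simp
  hence h_lim: "h \<longlonglongrightarrow> 0"
    by (rule tendsto_sandwich[OF _ _ tendsto_const, rotated -1])
       (use h_nonneg p_nonneg in \<open>auto simp: h_def\<close>)
  have fin: "finite {d. h d \<ge> t}" if "t > 0" for t
  proof -
    have "eventually (\<lambda>d. h d < t) sequentially" using h_lim that by (rule order_tendstoD)
    hence "finite {d. \<not> h d < t}" by (simp add: eventually_cofinite[symmetric] cofinite_eq_sequentially)
    thus ?thesis by (simp add: not_less)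
  qed
  have "h d = 0"
  proof (rule ccontr)
    assume "h d \<noteq> 0"
    hence hd: "h d > 0" using h_nonneg[of d] by simp
    \<comment> \<open>h exceeds a positive level only finitely often, so its maximum t and the largest maximiser i exist.\<close>
    define t where "t = Max (h ` {e. h e \<ge> h d})"
    have t_ge: "h e \<le> t" for e
    proof (cases "h e \<ge> h d")
      case True
      thus ?thesis unfolding t_def using fin[OF hd] by (intro Max_ge) auto
    next
      case False
      moreover have "h d \<le> t" unfolding t_def using fin[OF hd] by (intro Max_ge) auto
      ultimately show ?thesis by linarith
    qed
    have t_pos: "t > 0" using t_ge[of d] hd by linarith
    have "t \<in> h ` {e. h e \<ge> h d}" unfolding t_def using fin[OF hd] by (intro Max_in) auto
    hence ne: "{e. h e \<ge> t} \<noteq> {}" by auto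
    define i where "i = Max {e. h e \<ge> t}"
    have "i \<in> {e. h e \<ge> t}" unfolding i_def using fin[OF t_pos] ne by (intro Max_in)
    hence hi: "h i = t" using t_ge[of i] by simp
    have i_max: "e \<le> i" if "h e = t" for e unfolding i_def using fin[OF t_pos] that by (intro Max_ge) auto
    have i: "i \<ge> 1" using hi h_0 t_pos by (cases i) auto
    have int: "integrable (measure_pmf \<mu>) (\<lambda>k. h (nat \<bar>int i - int k\<bar>))"
      using h_nonneg h_le_1 by (intro integrable_pmf_bounded[where B = 1]) auto
    have "measure_pmf.expectation \<mu> (\<lambda>k. t - h (nat \<bar>int i - int k\<bar>)) = 0"
      using int hi h_harmonic[OF i] by simp
    hence "AE k in measure_pmf \<mu>. t - h (nat \<bar>int i - int k\<bar>) = 0"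
      using int t_ge by (subst (asm) integral_nonneg_eq_0_iff_AE) auto
    hence eq: "h (nat \<bar>int i - int k\<bar>) = t" if "k \<in> set_pmf \<mu>" for k
      using that by (auto simp: AE_measure_pmf_iff)
    obtain k where k: "k > 2 * i" "k \<in> set_pmf \<mu>" using unbounded by blast
    have "nat \<bar>int i - int k\<bar> > i" using k(1) by linarith
    thus False using i_max[OF eq[OF k(2)]] by linarith
  qed
  thus ?thesis using p[of d] by (simp add: h_def)
qed

end

section \<open>Meeting of ancestral lines\<close>

text \<open>
  The lines from a and b meet within n steps when only the larger of the two current points is
  moved. This order of exploration is what makes each jump independent of the future.
\<close>

primrec meets :: "nat \<Rightarrow> int \<Rightarrow> int \<Rightarrow> (int \<Rightarrow> nat) \<Rightarrow> bool" where
  "meets 0 a b r \<longleftrightarrow> a = b"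
| "meets (Suc n) a b r \<longleftrightarrow> a = b \<or> (a > b \<and> meets n (a - int (r a)) b r) \<or> (a < b \<and> meets n a (b - int (r b)) r)"

lemma meets_commute: "meets n a b r \<longleftrightarrow> meets n b a r"
  by (induction n arbitrary: a b) auto

lemma meets_Suc: "meets n a b r \<Longrightarrow> meets (Suc n) a b r"
proof (induction n arbitrary: a b)
  case (Suc n)
  from Suc.prems consider "a = b" | "a > b" "meets n (a - int (r a)) b r" | "a < b" "meets n a (b - int (r b)) r"
    by auto
  thus ?case
    by cases (use Suc.IH in \<open>simp_all only: meets.simps(2)[of "Suc n"], simp_all\<close>)
qed simp

text \<open>
  The exploration never looks at jumps to the right of its current points; this is the
  source of independence.
\<close>

lemma meets_cong:
  assumes "\<And>k. k < c \<Longrightarrow> r k = r' k" "a < c" "b < c"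
  shows "meets n a b r \<longleftrightarrow> meets n a b r'"
  using assms(2,3)
proof (induction n arbitrary: a b)
  case (Suc n)
  have "a - int (r a) < c" "b - int (r b) < c" "r a = r' a" "r b = r' b"
    using Suc.prems assms(1) by auto
  thus ?case using Suc.prems by (simp add: Suc.IH)
qed simp

lemma meets_measurable:
  assumes "a < c" "b < c"
  shows "Measurable.pred (\<Pi>\<^sub>M i\<in>{..<c}. count_space UNIV) (meets n a b)"
  using assms
proof (induction n arbitrary: a b)
  case 0
  have "meets 0 a b = (\<lambda>_. a = b)" by auto
  thus ?case by simp
next
  case (Suc n)
  have [measurable]: "(\<lambda>r. r x) \<in> measurable (\<Pi>\<^sub>M i\<in>{..<c}. count_space (UNIV :: nat set)) (count_space UNIV)"
    if "x < c" for x using that by (intro measurable_component_singleton) auto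
  have [measurable]: "Measurable.pred (\<Pi>\<^sub>M i\<in>{..<c}. count_space UNIV) (meets n (a - int k) b)"
      "Measurable.pred (\<Pi>\<^sub>M i\<in>{..<c}. count_space UNIV) (meets n a (b - int k))" for k
    using Suc.prems by (auto intro: Suc.IH)
  note Suc.prems [measurable]
  have "meets (Suc n) a b = (\<lambda>r. a = b \<or>
      (a > b \<and> (\<exists>k. r a = k \<and> meets n (a - int k) b r)) \<or>
      (a < b \<and> (\<exists>k. r b = k \<and> meets n a (b - int k) r)))"
    by auto
  moreover have "Measurable.pred (\<Pi>\<^sub>M i\<in>{..<c}. count_space UNIV) (\<lambda>r. a = b \<or>
      (a > b \<and> (\<exists>k. r a = k \<and> meets n (a - int k) b r)) \<or>
      (a < b \<and> (\<exists>k. r b = k \<and> meets n a (b - int k) r)))"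
    by measurable
  ultimately show ?case by (simp only:)
qed

text \<open>
  Meeting of forward orbits is an equivalence relation for every self-map f, hence it is the relation of being in
  the same component of the functional graph. It holds on the whole sample space, also where
  some jump is 0, and thus yields measurability of the component event.
\<close>

lemma ancestral_lines_meet_iff:
  fixes r :: "int \<Rightarrow> nat"
  defines "f \<equiv> \<lambda>i. i - int (r i)"
  shows "same_component (jump_graph r) a b \<longleftrightarrow> (\<exists>k l. (f ^^ k) a = (f ^^ l) b)"
proof
  assume "same_component (jump_graph r) a b"
  hence "(a, b) \<in> (jump_graph r \<union> (jump_graph r)\<inverse>)\<^sup>*" by (simp add: same_component_def)
  thus "\<exists>k l. (f ^^ k) a = (f ^^ l) b"
  proof (induction rule: rtrancl_induct)
    case base
    show ?case by blast
  next
    case (step y z)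
    then obtain k l where kl: "(f ^^ k) a = (f ^^ l) y" by blast
    from step.hyps(2) consider "z = f y" | "y = f z"
      by (auto simp: jump_graph_def f_def)
    thus ?case
    proof cases
      case 1
      have "(f ^^ Suc k) a = (f ^^ l) z" using kl by (simp add: 1 funpow_swap1)
      thus ?thesis by blast
    next
      case 2
      have "(f ^^ k) a = (f ^^ Suc l) z" using kl by (simp add: 2 funpow_swap1)
      thus ?thesis by blast
    qed
  qed
next
  let ?E = "jump_graph r \<union> (jump_graph r)\<inverse>"
  have line: "(x, (f ^^ k) x) \<in> ?E\<^sup>*" for x k
  proof (induction k)
    case (Suc k)
    have "((f ^^ k) x, f ((f ^^ k) x)) \<in> ?E" by (auto simp: jump_graph_def f_def)
    thus ?case using Suc by (simp add: rtrancl.rtrancl_into_rtrancl)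
  qed simp
  have "sym ?E" by (auto simp: sym_def)
  hence sym: "sym (?E\<^sup>*)" by (rule sym_rtrancl)
  assume "\<exists>k l. (f ^^ k) a = (f ^^ l) b"
  then obtain k l where "(f ^^ k) a = (f ^^ l) b" by blast
  hence "(a, (f ^^ k) a) \<in> ?E\<^sup>*" "((f ^^ k) a, b) \<in> ?E\<^sup>*"
    using line[of a k] symD[OF sym line[of b l]] by auto
  thus "same_component (jump_graph r) a b"
    unfolding same_component_def by (rule rtrancl_trans)
qed

text \<open>
  Positive jumps make the orbits strictly decreasing, so the larger of two distinct points is not
  on the orbit of the smaller one. If the orbits meet, a meeting point therefore remains ahead
  after the larger point has moved.
\<close>

lemma same_component_iff_meets:
  assumes pos: "\<And>i. r i > 0"
  shows "same_component (jump_graph r) a b \<longleftrightarrow> (\<exists>n. meets n a b r)"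
proof -
  define f where "f = (\<lambda>i. i - int (r i))"
  have f_less: "f i < i" for i using pos[of i] by (simp add: f_def)
  have f_le: "(f ^^ k) i \<le> i" for k i
    by (induction k) (use f_less in \<open>auto intro: order_trans less_imp_le\<close>)
  have "\<exists>k l. (f ^^ k) a = (f ^^ l) b" if "meets n a b r" for n
    using that
  proof (induction n arbitrary: a b)
    case 0
    thus ?case by (auto intro: exI[of _ "0::nat"])
  next
    case (Suc n)
    from Suc.prems consider "a = b" | "meets n (f a) b r" | "meets n a (f b) r"
      by (auto simp: f_def)
    thus ?case
    proof cases
      case 2
      then obtain k l where "(f ^^ k) (f a) = (f ^^ l) b" using Suc.IH by blast
      hence "(f ^^ Suc k) a = (f ^^ l) b" by (simp add: funpow_swap1)
      thus ?thesis by blast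
    next
      case 3
      then obtain k l where "(f ^^ k) a = (f ^^ l) (f b)" using Suc.IH by blast
      hence "(f ^^ k) a = (f ^^ Suc l) b" by (simp add: funpow_swap1)
      thus ?thesis by blast
    qed blast
  qed
  moreover have "meets (k + l) a b r" if "(f ^^ k) a = (f ^^ l) b" for k l
    using that
  proof (induction "k + l" arbitrary: k l a b)
    case 0
    thus ?case by simp
  next
    case (Suc n)
    consider "a = b" | "a > b" | "a < b" by linarith
    thus ?case
    proof cases
      case 1
      thus ?thesis using Suc.hyps(2)[symmetric] by simp
    next
      case 2
      have "k \<noteq> 0" using Suc.prems f_le[of l b] 2 by (intro notI) auto
      then obtain k' where k: "k = Suc k'" by (cases k) auto
      have "meets (k' + l) (f a) b r"
        by (rule Suc.hyps(1)) (use Suc.hyps(2) Suc.prems k in \<open>auto simp: funpow_swap1\<close>)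
      thus ?thesis using 2 by (simp add: k f_def)
    next
      case 3
      have "l \<noteq> 0" using Suc.prems f_le[of k a] 3 by (intro notI) auto
      then obtain l' where l: "l = Suc l'" by (cases l) auto
      have "meets (k + l') a (f b) r"
        by (rule Suc.hyps(1)) (use Suc.hyps(2) Suc.prems l in \<open>auto simp: funpow_swap1\<close>)
      thus ?thesis using 3 by (simp add: l f_def)
    qed
  qed
  ultimately show ?thesis
    unfolding ancestral_lines_meet_iff f_def[symmetric] by blast
qed

section \<open>Independent jumps\<close>

lemma pmf_expectation_sums:
  fixes \<mu> :: "nat pmf" and f :: "nat \<Rightarrow> real"
  assumes "\<And>k. \<bar>f k\<bar> \<le> B"
  shows "(\<lambda>k. pmf \<mu> k * f k) sums measure_pmf.expectation \<mu> f"
proof -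
  have "integrable (measure_pmf \<mu>) f" by (rule integrable_pmf_bounded) (rule assms)
  hence "integrable (count_space UNIV) (\<lambda>k. pmf \<mu> k * f k)"
    unfolding measure_pmf_eq_density by (subst (asm) integrable_density) auto
  hence "(\<lambda>k. pmf \<mu> k * f k) sums (\<integral>k. pmf \<mu> k * f k \<partial>count_space UNIV)"
    by (rule sums_integral_count_space_nat)
  also have "(\<integral>k. pmf \<mu> k * f k \<partial>count_space UNIV) = measure_pmf.expectation \<mu> f"
    unfolding measure_pmf_eq_density by (subst integral_density) auto
  finally show ?thesis .
qed

locale iid_jumps = prob_space M for M :: "'a measure" +
  fixes R :: "int \<Rightarrow> 'a \<Rightarrow> nat" and \<mu> :: "nat pmf"
  assumes jumps_indep: "indep_vars (\<lambda>_. count_space UNIV) R UNIV"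
    and jump_distr: "distr M (count_space UNIV) (R i) = measure_pmf \<mu>"
    and no_zero_jump: "pmf \<mu> 0 = 0"
begin

lemma R_measurable [measurable]: "R i \<in> measurable M (count_space UNIV)"
  using jumps_indep by (auto simp: indep_vars_def)

lemma prob_jump: "prob (R i -` {k} \<inter> space M) = pmf \<mu> k"
  using measure_distr[OF R_measurable[of i], of "{k}"] by (simp add: jump_distr measure_pmf_single)

lemma AE_jumps_pos: "AE \<omega> in M. \<forall>i. R i \<omega> > 0"
  unfolding AE_all_countable
proof
  fix i
  have "prob {\<omega> \<in> space M. R i \<omega> = 0} = 0"
    using prob_jump[of i 0] no_zero_jump by (simp add: vimage_def Int_def conj_commute)
  hence "AE \<omega> in M. \<not> R i \<omega> = 0" by (subst (asm) prob_eq_0) auto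
  thus "AE \<omega> in M. R i \<omega> > 0" by simp
qed

lemma meets_restrict:
  assumes "a < c" "b < c"
  shows "meets n a b (\<lambda>k. R k \<omega>) \<longleftrightarrow> meets n a b (restrict (\<lambda>k. R k \<omega>) {..<c})"
  by (rule meets_cong) (use assms in auto)

lemma meets_event_measurable [measurable]: "Measurable.pred M (\<lambda>\<omega>. meets n a b (\<lambda>k. R k \<omega>))"
proof -
  define c where "c = max a b + 1"
  have c: "a < c" "b < c" by (auto simp: c_def)
  have "(\<lambda>\<omega>. restrict (\<lambda>k. R k \<omega>) {..<c}) \<in> measurable M (\<Pi>\<^sub>M i\<in>{..<c}. count_space UNIV)"
    by (intro measurable_restrict R_measurable)
  from measurable_compose[OF this meets_measurable[OF c]]
  show ?thesis unfolding meets_restrict[OF c] .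
qed

text \<open>
  For k \<ge> 1 the remaining exploration only involves jumps strictly to the left of a, which
  are independent of R a; for k = 0 both sides vanish.
\<close>

lemma prob_jump_and_meets:
  assumes "b < a"
  shows "prob {\<omega> \<in> space M. R a \<omega> = k \<and> meets n (a - int k) b (\<lambda>k. R k \<omega>)} =
           pmf \<mu> k * prob {\<omega> \<in> space M. meets n (a - int k) b (\<lambda>k. R k \<omega>)}"
proof (cases "k = 0")
  case True
  have "prob {\<omega> \<in> space M. R a \<omega> = k \<and> meets n (a - int k) b (\<lambda>k. R k \<omega>)} \<le> prob (R a -` {k} \<inter> space M)"
    by (intro finite_measure_mono) auto
  thus ?thesis using measure_nonneg[of M] no_zero_jump
    by (simp add: prob_jump True order_antisym)
next
  case False
  hence ak: "a - int k < a" by simp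
  let ?N = "\<lambda>J. \<Pi>\<^sub>M i\<in>J. count_space (UNIV :: nat set)"
  define A B where "A = {r \<in> space (?N {a}). r a = k}"
    and "B = {r \<in> space (?N {..<a}). meets n (a - int k) b r}"
  have "indep_var (?N {a}) (\<lambda>\<omega>. restrict (\<lambda>i. R i \<omega>) {a}) (?N {..<a}) (\<lambda>\<omega>. restrict (\<lambda>i. R i \<omega>) {..<a})"
    by (rule indep_var_restrict[OF jumps_indep]) auto
  moreover have "A \<in> sets (?N {a})" unfolding A_def by measurable
  moreover have "B \<in> sets (?N {..<a})"
    unfolding B_def using meets_measurable[OF ak assms] by (simp add: pred_def)
  ultimately have "prob ((\<lambda>\<omega>. (restrict (\<lambda>i. R i \<omega>) {a}, restrict (\<lambda>i. R i \<omega>) {..<a})) -` (A \<times> B) \<inter> space M) =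
      prob ((\<lambda>\<omega>. restrict (\<lambda>i. R i \<omega>) {a}) -` A \<inter> space M) * prob ((\<lambda>\<omega>. restrict (\<lambda>i. R i \<omega>) {..<a}) -` B \<inter> space M)"
    by (rule indep_varD)
  also have "(\<lambda>\<omega>. (restrict (\<lambda>i. R i \<omega>) {a}, restrict (\<lambda>i. R i \<omega>) {..<a})) -` (A \<times> B) \<inter> space M =
      {\<omega> \<in> space M. R a \<omega> = k \<and> meets n (a - int k) b (\<lambda>k. R k \<omega>)}"
    unfolding meets_restrict[OF ak assms] by (auto simp: A_def B_def space_PiM)
  also have "(\<lambda>\<omega>. restrict (\<lambda>i. R i \<omega>) {a}) -` A \<inter> space M = R a -` {k} \<inter> space M"
    by (auto simp: A_def space_PiM)
  also have "(\<lambda>\<omega>. restrict (\<lambda>i. R i \<omega>) {..<a}) -` B \<inter> space M =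
      {\<omega> \<in> space M. meets n (a - int k) b (\<lambda>k. R k \<omega>)}"
    unfolding meets_restrict[OF ak assms] by (auto simp: B_def space_PiM)
  finally show ?thesis by (simp add: prob_jump)
qed

lemma prob_meets: "prob {\<omega> \<in> space M. meets n a b (\<lambda>k. R k \<omega>)} = meeting_prob \<mu> n (nat \<bar>a - b\<bar>)"
proof (induction n arbitrary: a b)
  case 0
  show ?case by (cases "a = b") (auto simp: prob_space)
next
  case (Suc n)
  have step: "prob {\<omega> \<in> space M. meets (Suc n) a b (\<lambda>k. R k \<omega>)} = meeting_prob \<mu> (Suc n) (nat \<bar>a - b\<bar>)"
    if ba: "b < a" for a b
  proof -
    define E where "E k = {\<omega> \<in> space M. R a \<omega> = k \<and> meets n (a - int k) b (\<lambda>k. R k \<omega>)}" for k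
    have "{\<omega> \<in> space M. meets (Suc n) a b (\<lambda>k. R k \<omega>)} = (\<Union>k. E k)"
      using ba by (auto simp: E_def)
    moreover have "(\<lambda>k. prob (E k)) sums prob (\<Union>k. E k)"
    proof (rule finite_measure_UNION)
      show "range E \<subseteq> events" unfolding E_def by auto
      show "disjoint_family E" by (auto simp: disjoint_family_on_def E_def)
    qed
    moreover have "prob (E k) = pmf \<mu> k * meeting_prob \<mu> n (nat \<bar>int (nat \<bar>a - b\<bar>) - int k\<bar>)" for k
      unfolding E_def prob_jump_and_meets[OF ba] Suc.IH using ba by (simp add: algebra_simps)
    ultimately have "(\<lambda>k. pmf \<mu> k * meeting_prob \<mu> n (nat \<bar>int (nat \<bar>a - b\<bar>) - int k\<bar>)) sums
        prob {\<omega> \<in> space M. meets (Suc n) a b (\<lambda>k. R k \<omega>)}"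
      by simp
    moreover have "(\<lambda>k. pmf \<mu> k * meeting_prob \<mu> n (nat \<bar>int (nat \<bar>a - b\<bar>) - int k\<bar>)) sums
        measure_pmf.expectation \<mu> (\<lambda>k. meeting_prob \<mu> n (nat \<bar>int (nat \<bar>a - b\<bar>) - int k\<bar>))"
      by (rule pmf_expectation_sums[where B = 1]) (use meeting_prob_range in auto)
    ultimately show ?thesis using ba by (simp add: sums_unique2)
  qed
  consider "a = b" | "b < a" | "a < b" by linarith
  thus ?case
  proof cases
    case 1
    thus ?thesis by (simp add: prob_space)
  next
    case 3
    thus ?thesis using step[of a b] meets_commute[of "Suc n" a b] by (simp only: abs_minus_commute)
  qed (rule step)
qed

text \<open>
  The event is expressed by the orbits, which are measurable as countable compositions.
\<close>

lemma same_component_measurable [measurable]: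
  "Measurable.pred M (\<lambda>\<omega>. same_component (jump_graph (\<lambda>k. R k \<omega>)) a b)"
proof -
  have [measurable]: "(\<lambda>\<omega>. ((\<lambda>i. i - int (R i \<omega>)) ^^ k) x) \<in> measurable M (count_space UNIV)" for k x
  proof (induction k)
    case (Suc k)
    have "(\<lambda>\<omega>. i - int (R i \<omega>)) \<in> measurable M (count_space UNIV)" for i by measurable
    from measurable_compose_countable[OF this Suc] show ?case by simp
  qed simp
  show ?thesis unfolding ancestral_lines_meet_iff by measurable
qed

lemma prob_same_component_limit:
  "(\<lambda>n. meeting_prob \<mu> n (nat \<bar>a - b\<bar>)) \<longlonglongrightarrow>
     prob {\<omega> \<in> space M. same_component (jump_graph (\<lambda>k. R k \<omega>)) a b}"
proof -
  define H where "H n = {\<omega> \<in> space M. meets n a b (\<lambda>k. R k \<omega>)}" for n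
  have "(\<lambda>n. prob (H n)) \<longlonglongrightarrow> prob (\<Union>n. H n)"
  proof (rule finite_Lim_measure_incseq)
    show "range H \<subseteq> events" unfolding H_def by auto
    show "incseq H" unfolding H_def by (intro incseq_SucI) (auto intro: meets_Suc simp del: meets.simps)
  qed
  also have "prob (\<Union>n. H n) = prob {\<omega> \<in> space M. same_component (jump_graph (\<lambda>k. R k \<omega>)) a b}"
  proof (rule measure_eq_AE)
    show "AE \<omega> in M. (\<omega> \<in> (\<Union>n. H n)) = (\<omega> \<in> {\<omega> \<in> space M. same_component (jump_graph (\<lambda>k. R k \<omega>)) a b})"
      using AE_jumps_pos by eventually_elim (auto simp: H_def same_component_iff_meets)
    show "(\<Union>n. H n) \<in> events" unfolding H_def by measurable
  qed measurable
  finally show ?thesis by (simp add: H_def prob_meets)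
qed

end

section \<open>Power-law jumps\<close>

lemma asymp_equiv_ratio_tendsto:
  fixes f g :: "nat \<Rightarrow> real"
  assumes "f \<sim>[sequentially] g" and "\<And>n. n \<ge> 1 \<Longrightarrow> g n > 0"
  shows "(\<lambda>n. f n / g n) \<longlonglongrightarrow> 1"
proof -
  have "eventually (\<lambda>n. f n / g n = (if f n = 0 \<and> g n = 0 then 1 else f n / g n)) sequentially"
    using eventually_ge_at_top[of 1] by eventually_elim (use assms(2) in force)
  thus ?thesis using assms(1) unfolding asymp_equiv_def by (simp add: tendsto_cong)
qed

locale power_law_renewal =
  fixes \<alpha> :: real and L :: "real \<Rightarrow> real" and \<mu> :: "nat pmf"
  assumes alpha: "0 < \<alpha>" "\<alpha> < 1 / 2"
    and L_pos: "L x > 0"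
    and L_slow: "slowly_varying L"
    and tail: "(\<lambda>n::nat. measure_pmf.prob \<mu> {n..}) \<sim>[sequentially] (\<lambda>n. real n powr (-\<alpha>) * L (real n))"
    and weights: "renewal_weight \<mu> \<sim>[sequentially]
           (\<lambda>n. 1 / (Gamma \<alpha> * Gamma (1 - \<alpha>)) * (real n powr (\<alpha> - 1) / L (real n)))"
begin

definition T :: "nat \<Rightarrow> real" where "T n = measure_pmf.prob \<mu> {n..}"

definition c :: real where "c = 1 / (Gamma \<alpha> * Gamma (1 - \<alpha>))"

lemma c_pos: "c > 0"
  using alpha by (simp add: c_def Gamma_real_pos)

lemma T_mono: "m \<le> n \<Longrightarrow> T n \<le> T m"
  unfolding T_def by (intro measure_pmf.finite_measure_mono) auto

lemma T_ratio: "(\<lambda>n. T n / (real n powr (-\<alpha>) * L (real n))) \<longlonglongrightarrow> 1"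
  using asymp_equiv_ratio_tendsto[OF tail] L_pos by (simp add: T_def)

text \<open>
  The ratio to a positive sequence tends to 1, so T is positive far out, hence everywhere by monotonicity.
\<close>

lemma T_positive: "T n > 0"
proof -
  have "eventually (\<lambda>n. T n / (real n powr (-\<alpha>) * L (real n)) > 0) sequentially"
    by (rule order_tendstoD(1)[OF T_ratio]) simp
  then obtain m where m: "m \<ge> n" "T m / (real m powr (-\<alpha>) * L (real m)) > 0"
    unfolding eventually_sequentially by (meson linear order_refl le_trans)
  hence "T m \<noteq> 0" by auto
  moreover have "T m \<ge> 0" by (simp add: T_def)
  ultimately show ?thesis using T_mono[OF m(1)] by linarith
qed

lemma unbounded_support: "\<exists>k>n. k \<in> set_pmf \<mu>"
proof (rule ccontr)
  assume "\<not> (\<exists>k>n. k \<in> set_pmf \<mu>)"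
  hence "set_pmf \<mu> \<inter> {Suc n..} = {}" by auto
  hence "T (Suc n) = 0" unfolding T_def by (simp add: measure_pmf_zero_iff)
  thus False using T_positive[of "Suc n"] by simp
qed

lemma T_regularly_varying:
  assumes k: "k \<ge> (1::nat)"
  shows "(\<lambda>n. T (k * n) / T n) \<longlonglongrightarrow> real k powr (-\<alpha>)"
proof -
  have kn: "filterlim (\<lambda>n. k * n) sequentially sequentially"
    using k by (auto intro!: filterlim_subseq simp: strict_mono_def)
  have "((\<lambda>x. L (real k * x) / L x) \<longlongrightarrow> 1) at_top"
    using L_slow k unfolding slowly_varying_def by auto
  hence L: "(\<lambda>n. L (real k * real n) / L (real n)) \<longlonglongrightarrow> 1"
    by (rule filterlim_compose) (rule filterlim_real_sequentially)
  have "(\<lambda>n. (T (k * n) / (real (k * n) powr (-\<alpha>) * L (real (k * n)))) /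
              (T n / (real n powr (-\<alpha>) * L (real n))) *
              (real k powr (-\<alpha>) * (L (real k * real n) / L (real n)))) \<longlonglongrightarrow> 1 / 1 * (real k powr (-\<alpha>) * 1)"
    by (intro tendsto_mult tendsto_divide tendsto_const L T_ratio filterlim_compose[OF T_ratio kn]) simp
  also have "1 / 1 * (real k powr (-\<alpha>) * 1) = real k powr (-\<alpha>)" by simp
  finally show ?thesis
  proof (rule Lim_transform_eventually)
    show "eventually (\<lambda>n. (T (k * n) / (real (k * n) powr (-\<alpha>) * L (real (k * n)))) /
              (T n / (real n powr (-\<alpha>) * L (real n))) *
              (real k powr (-\<alpha>) * (L (real k * real n) / L (real n))) = T (k * n) / T n) sequentially"
      using eventually_gt_at_top[of 0]
    proof eventually_elim
      case (elim n)
      have "L (real n) \<noteq> 0" "L (real k * real n) \<noteq> 0" "T n \<noteq> 0"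
        using L_pos[of "real n"] L_pos[of "real k * real n"] T_positive[of n] by auto
      thus ?case using elim k by (simp add: powr_mult)
    qed
  qed
qed

lemma scaled_weights_tendsto: "(\<lambda>n. renewal_weight \<mu> n * (real n * T n)) \<longlonglongrightarrow> c"
proof -
  have "(\<lambda>n. renewal_weight \<mu> n / (c * (real n powr (\<alpha> - 1) / L (real n)))) \<longlonglongrightarrow> 1"
    by (rule asymp_equiv_ratio_tendsto[OF weights[folded c_def]]) (use c_pos L_pos in auto)
  hence "(\<lambda>n. c * (renewal_weight \<mu> n / (c * (real n powr (\<alpha> - 1) / L (real n)))) *
            (T n / (real n powr (-\<alpha>) * L (real n)))) \<longlonglongrightarrow> c * 1 * 1"
    by (intro tendsto_mult tendsto_const T_ratio)
  hence "(\<lambda>n. c * (renewal_weight \<mu> n / (c * (real n powr (\<alpha> - 1) / L (real n)))) *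
            (T n / (real n powr (-\<alpha>) * L (real n)))) \<longlonglongrightarrow> c" by simp
  thus ?thesis
  proof (rule Lim_transform_eventually)
    show "eventually (\<lambda>n. c * (renewal_weight \<mu> n / (c * (real n powr (\<alpha> - 1) / L (real n)))) *
            (T n / (real n powr (-\<alpha>) * L (real n))) = renewal_weight \<mu> n * (real n * T n)) sequentially"
      using eventually_gt_at_top[of 0]
    proof eventually_elim
      case (elim n)
      have "L (real n) \<noteq> 0" using L_pos[of "real n"] by auto
      moreover have "real n powr (\<alpha> - 1) = 1 / (real n * real n powr (-\<alpha>))"
        using elim by (simp add: powr_diff powr_minus field_simps)
      ultimately show ?case using elim c_pos by simp
    qed
  qed
qed

sublocale renewal_asymptotics T \<alpha> "renewal_weight \<mu>" c
proof
  show "0 < \<alpha>" "\<alpha> < 1 / 2" "c > 0" by (fact alpha c_pos)+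
  show "T n > 0" "renewal_weight \<mu> n \<ge> 0" for n by (fact T_positive renewal_weight_nonneg)+
  show "m \<le> n \<Longrightarrow> T n \<le> T m" for m n by (rule T_mono)
  show "k \<ge> 1 \<Longrightarrow> (\<lambda>n. T (k * n) / T n) \<longlonglongrightarrow> real k powr (-\<alpha>)" for k by (rule T_regularly_varying)
  show "(\<lambda>n. renewal_weight \<mu> n * (real n * T n)) \<longlonglongrightarrow> c" by (rule scaled_weights_tendsto)
qed

sublocale square_summable_renewal \<mu> "renewal_weight \<mu>"
  by unfold_locales
     (use renewal_weight_0 renewal_weight_nonneg renewal_weight_le_1 renewal_weight_recurrence
        Q_square_summable in auto)

text \<open>
  Beta \<alpha> (1 - 2 * \<alpha>) = \<Gamma>(\<alpha>) \<Gamma>(1 - 2 \<alpha>) / \<Gamma>(1 - \<alpha>), and one factor \<Gamma>(\<alpha>) cancels against c ^ 2.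
\<close>

lemma limit_eq_connection_const: "c\<^sup>2 * Beta \<alpha> (1 - 2 * \<alpha>) / correlation 0 = connection_const \<mu> \<alpha>"
proof -
  have "Gamma \<alpha> > 0" "Gamma (1 - \<alpha>) > 0" using alpha by (auto intro: Gamma_real_pos)
  moreover have "\<alpha> + (1 - 2 * \<alpha>) = 1 - \<alpha>" by simp
  ultimately show ?thesis
    by (simp add: c_def Beta_def connection_const_def correlation_0 power2_eq_square power3_eq_cube
        field_simps)
qed

lemma connection_const_pos: "connection_const \<mu> \<alpha> > 0"
  using alpha correlation_0_pos
  by (auto simp: connection_const_def correlation_0[symmetric] intro!: divide_pos_pos mult_pos_pos Gamma_real_pos zero_less_power)

lemma normalized_correlation_asymp:
  "(\<lambda>i. correlation i / correlation 0) \<sim>[sequentially]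
     (\<lambda>i. connection_const \<mu> \<alpha> * (real i powr (2 * \<alpha> - 1) / (L (real i))\<^sup>2))"
proof (rule asymp_equivI')
  define K where "K = connection_const \<mu> \<alpha>"
  have K: "K > 0" unfolding K_def by (rule connection_const_pos)
  have "(\<lambda>i. correlation i * (real i * (T i)\<^sup>2) / correlation 0) \<longlonglongrightarrow> K"
    unfolding K_def limit_eq_connection_const[symmetric]
    using correlation_asymptotics correlation_0_pos unfolding correlation_def
    by (intro tendsto_divide tendsto_const) auto
  hence "(\<lambda>i. (correlation i * (real i * (T i)\<^sup>2) / correlation 0) / K / (T i / (real i powr (-\<alpha>) * L (real i)))\<^sup>2) \<longlonglongrightarrow> K / K / 1\<^sup>2"
    using K by (intro tendsto_divide[OF tendsto_divide[OF _ tendsto_const] tendsto_power[OF T_ratio]]) auto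
  hence "(\<lambda>i. (correlation i * (real i * (T i)\<^sup>2) / correlation 0) / K / (T i / (real i powr (-\<alpha>) * L (real i)))\<^sup>2) \<longlonglongrightarrow> 1"
    using K by simp
  thus "(\<lambda>i. correlation i / correlation 0 / (connection_const \<mu> \<alpha> * (real i powr (2 * \<alpha> - 1) / (L (real i))\<^sup>2))) \<longlonglongrightarrow> 1"
  proof (rule Lim_transform_eventually)
    show "eventually (\<lambda>i. (correlation i * (real i * (T i)\<^sup>2) / correlation 0) / K / (T i / (real i powr (-\<alpha>) * L (real i)))\<^sup>2
       = correlation i / correlation 0 / (connection_const \<mu> \<alpha> * (real i powr (2 * \<alpha> - 1) / (L (real i))\<^sup>2))) sequentially"
      using eventually_gt_at_top[of 0]
    proof eventually_elim
      case (elim i)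
      have "L (real i) \<noteq> 0" "T i \<noteq> 0" using L_pos[of "real i"] T_positive[of i] by auto
      moreover have "real i powr (2 * \<alpha> - 1) = 1 / (real i * (real i powr (-\<alpha>))\<^sup>2)"
        using elim by (simp add: power2_eq_square powr_diff powr_minus powr_add[symmetric] field_simps)
      ultimately show ?case unfolding K_def[symmetric]
        using elim K correlation_0_pos by (simp add: power2_eq_square)
    qed
  qed
qed

end

theorem proposition2p1:
  fixes \<alpha> :: real and L :: "real \<Rightarrow> real" and \<mu> :: "nat pmf"
    and M :: "'a measure" and R :: "int \<Rightarrow> 'a \<Rightarrow> nat"
  assumes "0 < \<alpha>" and "\<alpha> < 1 / 2"
    and "\<And>x. L x > 0" and "slowly_varying L"
    and "pmf \<mu> 0 = 0"
    and "(\<lambda>n::nat. measure_pmf.prob \<mu> {n..}) \<sim>[sequentially] (\<lambda>n. real n powr (-\<alpha>) * L (real n))"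
    and "Gcd {n::nat. pmf \<mu> n > 0} = 1"
    and "renewal_weight \<mu> \<sim>[sequentially]
           (\<lambda>n. 1 / (Gamma \<alpha> * Gamma (1 - \<alpha>)) * (real n powr (\<alpha> - 1) / L (real n)))"
    and "prob_space M"
    and "prob_space.indep_vars M (\<lambda>_. count_space UNIV) R UNIV"
    and "\<And>i. distr M (count_space UNIV) (R i) = measure_pmf \<mu>"
  shows "(\<lambda>i::nat. measure M {\<omega> \<in> space M. same_component (jump_graph (\<lambda>k. R k \<omega>)) 0 (int i)})
           \<sim>[sequentially]
         (\<lambda>i. connection_const \<mu> \<alpha> * (real i powr (2 * \<alpha> - 1) / (L (real i))\<^sup>2))"
proof -
  interpret power_law_renewal \<alpha> L \<mu>
    by unfold_locales (use assms in auto)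
  interpret iid_jumps M R \<mu>
    using assms by (auto simp: iid_jumps_def iid_jumps_axioms_def)
  have "measure M {\<omega> \<in> space M. same_component (jump_graph (\<lambda>k. R k \<omega>)) 0 (int i)} = correlation i / correlation 0" for i
  proof (rule LIMSEQ_unique)
    show "(\<lambda>n. meeting_prob \<mu> n i) \<longlonglongrightarrow> measure M {\<omega> \<in> space M. same_component (jump_graph (\<lambda>k. R k \<omega>)) 0 (int i)}"
      using prob_same_component_limit[of 0 "int i"] by simp
    have "correlation \<longlonglongrightarrow> 0"
      using correlation_tendsto_0 unfolding correlation_def .
    thus "(\<lambda>n. meeting_prob \<mu> n i) \<longlonglongrightarrow> correlation i / correlation 0"
      by (intro meeting_prob_tendsto unbounded_support)
  qed
  thus ?thesis using normalized_correlation_asymp by simp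
qed

end
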